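(* Let $G$ be a triangle-free plane graph with outer face $F$, let $P\subset F$ be a subpath of $F$ containing at most two vertices, and let $L$ be a $( *,1)$-list assignment on $G$ such that the following conditions are satisfied: (i) $|L(v)|\ge 3$ for every $v\in V(G)\setminus V(F)$; (ii) $|L(v)|\ge 2$ for every $v\in V(F)\setminus V(P)$; (iii) $|L(v)|=1$ for every $v\in V(P)$; (iv) no two vertices with lists of size two are adjacent in $G$; (v) the subgraph of $G$ induced by $V(P)$ is $L$-colorable. Then $G$ is $L$-colorable.
   Context: Graphs are finite and simple; a plane graph is a planar graph together with a fixed embedding in the plane. The outer face $F$ is identified with its boundary, so $V(F)$ is the set of vertices incident with the outer face, and a subpath of $F$ is a path that is a subgraph of the boundary of the outer face; $P$ is allowed to be empty. A graph is triangle-free if it has no cycle of length $3$ as a subgraph. A list assignment $L$ on $G$ assigns to each vertex $v$ a set $L(v)$ of colors. A $( *,1)$-list assignment is a list assignment $L$ with $|L(v)|\ge 1$ for every vertex $v$ and $|L(u)\cap L(v)|\le 1$ for every pair of adjacent vertices $u,v$. An $L$-coloring of a graph is a function $\varphi$ on its vertices with $\varphi(v)\in L(v)$ for every vertex $v$ and $\varphi(x)\neq\varphi(y)$ for every edge $xy$; a graph is $L$-colorable if it has an $L$-coloring. *)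

theory Defs
  imports "HOL-Analysis.Analysis" "HOL-Library.Extended_Nat"
begin

locale simple_graph =
  fixes V :: "'a set" and E :: "'a set set"
  assumes finite_vertices: "finite V"
    and edges: "\<And>e. e \<in> E \<Longrightarrow> e \<subseteq> V \<and> card e = 2"

text \<open>
  A path is given by its sequence of vertices; the empty path is allowed, and an edge
  between consecutive vertices is determined by its ends because the graph is simple.
\<close>

definition is_path :: "'a set \<Rightarrow> 'a set set \<Rightarrow> 'a list \<Rightarrow> bool" where
  "is_path V E p \<longleftrightarrow>
     distinct p \<and> set p \<subseteq> V \<and> (\<forall>i. Suc i < length p \<longrightarrow> {p ! i, p ! Suc i} \<in> E)"

definition is_cycle :: "'a set \<Rightarrow> 'a set set \<Rightarrow> 'a list \<Rightarrow> bool" where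
  "is_cycle V E c \<longleftrightarrow> is_path V E c \<and> 3 \<le> length c \<and> {last c, hd c} \<in> E"

definition triangle_free :: "'a set \<Rightarrow> 'a set set \<Rightarrow> bool" where
  "triangle_free V E \<longleftrightarrow> (\<nexists>c. is_cycle V E c \<and> length c = 3)"

definition induced_edges :: "'a set set \<Rightarrow> 'a set \<Rightarrow> 'a set set" where
  "induced_edges E W = {e \<in> E. e \<subseteq> W}"

text \<open>
  The embedding places each vertex at a point of the plane and draws each edge as an arc
  joining its ends. The arcs are arbitrary injective continuous curves; two of them meet only
  at a common end, and an arc contains no vertices other than its ends.
\<close>

locale plane_graph = simple_graph V E
  for V :: "'a set" and E :: "'a set set" +
  fixes pos :: "'a \<Rightarrow> complex" and curve :: "'a set \<Rightarrow> real \<Rightarrow> complex"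
  assumes inj_pos: "inj_on pos V"
    and arc_curve: "\<And>e. e \<in> E \<Longrightarrow> arc (curve e)"
    and curve_ends: "\<And>e. e \<in> E \<Longrightarrow> {pathstart (curve e), pathfinish (curve e)} = pos ` e"
    and curve_vertices: "\<And>e. e \<in> E \<Longrightarrow> path_image (curve e) \<inter> pos ` V = pos ` e"
    and curve_disjoint: "\<And>e f. \<lbrakk>e \<in> E; f \<in> E; e \<noteq> f\<rbrakk> \<Longrightarrow>
           path_image (curve e) \<inter> path_image (curve f) \<subseteq> pos ` (e \<inter> f)"

definition drawing ::
  "'a set \<Rightarrow> 'a set set \<Rightarrow> ('a \<Rightarrow> complex) \<Rightarrow> ('a set \<Rightarrow> real \<Rightarrow> complex) \<Rightarrow> complex set" where
  "drawing V E pos curve = pos ` V \<union> (\<Union>e\<in>E. path_image (curve e))"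

text \<open>
  The library constant \<^const>\<open>outside\<close> yields the union of the unbounded components of the
  complement; as a drawing is compact, there is exactly one of them.
\<close>

definition outer_face ::
  "'a set \<Rightarrow> 'a set set \<Rightarrow> ('a \<Rightarrow> complex) \<Rightarrow> ('a set \<Rightarrow> real \<Rightarrow> complex) \<Rightarrow> complex set" where
  "outer_face V E pos curve = outside (drawing V E pos curve)"

lemma (in plane_graph) outer_face_unbounded_component:
  shows "outer_face V E pos curve \<in> components (- drawing V E pos curve)"
    and "\<not> bounded (outer_face V E pos curve)"
    and "\<lbrakk>C \<in> components (- drawing V E pos curve); \<not> bounded C\<rbrakk>
           \<Longrightarrow> C = outer_face V E pos curve"
proof -
  let ?D = "drawing V E pos curve"
  have "E \<subseteq> Pow V"
    using edges by auto
  then have "finite E"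
    using finite_vertices by (simp add: finite_subset)
  moreover have "bounded (path_image (curve e))" if "e \<in> E" for e
    using arc_curve[OF that] by (simp add: arc_imp_path bounded_path_image)
  ultimately have bnd: "bounded ?D"
    by (auto simp: drawing_def finite_vertices finite_imp_bounded intro!: bounded_UN)
  show unb: "\<not> bounded (outer_face V E pos curve)"
    unfolding outer_face_def using bnd by (rule unbounded_outside)
  have conn: "connected (outside ?D)"
    using bnd by (intro connected_outside) auto
  have sub: "outside ?D \<subseteq> - ?D"
    using outside_no_overlap by blast
  have eq: "C = outside ?D" if C: "C \<in> components (- ?D)" "\<not> bounded C" for C
  proof -
    obtain x where x: "x \<in> - ?D" "C = connected_component_set (- ?D) x"
      using C(1) by (auto simp: components_iff)
    have "C \<subseteq> outside ?D"
    proof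
      fix y assume "y \<in> C"
      then have "C = connected_component_set (- ?D) y"
        using x(2) connected_component_eq by blast
      then show "y \<in> outside ?D"
        using C(2) by (simp add: outside)
    qed
    moreover have "x \<in> C"
      using x by simp
    ultimately have "C \<inter> outside ?D \<noteq> {}"
      by blast
    then have "outside ?D \<subseteq> C"
      using components_maximal[OF C(1) conn sub] by blast
    with \<open>C \<subseteq> outside ?D\<close> show ?thesis
      by blast
  qed
  have "outside ?D \<noteq> {}"
    using unb unfolding outer_face_def by auto
  then obtain x where x: "x \<in> outside ?D"
    by blast
  let ?C = "connected_component_set (- ?D) x"
  have "?C \<in> components (- ?D)" "\<not> bounded ?C"
    using x sub by (auto simp: outside components_iff)
  then show "outer_face V E pos curve \<in> components (- ?D)"
    using eq[of ?C] by (simp add: outer_face_def)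
  show "C = outer_face V E pos curve" if "C \<in> components (- ?D)" "\<not> bounded C"
    unfolding outer_face_def using that by (rule eq)
qed

text \<open>
  The boundary of the outer face, as a subgraph: the vertices and edges incident with the
  face, that is, those drawn in its topological frontier.
\<close>

definition outer_vertices ::
  "'a set \<Rightarrow> 'a set set \<Rightarrow> ('a \<Rightarrow> complex) \<Rightarrow> ('a set \<Rightarrow> real \<Rightarrow> complex) \<Rightarrow> 'a set" where
  "outer_vertices V E pos curve = {v \<in> V. pos v \<in> frontier (outer_face V E pos curve)}"

definition outer_edges ::
  "'a set \<Rightarrow> 'a set set \<Rightarrow> ('a \<Rightarrow> complex) \<Rightarrow> ('a set \<Rightarrow> real \<Rightarrow> complex) \<Rightarrow> 'a set set" where
  "outer_edges V E pos curve =
     {e \<in> E. path_image (curve e) \<subseteq> frontier (outer_face V E pos curve)}"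

text \<open>
  Lists of colors may be infinite, whereas \<^const>\<open>card\<close> is \<open>0\<close> on infinite sets; hence
  list sizes are extended natural numbers.
\<close>

definition list_size :: "'c set \<Rightarrow> enat" where
  "list_size A = (if finite A then enat (card A) else \<infinity>)"

definition star_one_list_assignment :: "'a set \<Rightarrow> 'a set set \<Rightarrow> ('a \<Rightarrow> 'c set) \<Rightarrow> bool" where
  "star_one_list_assignment V E L \<longleftrightarrow>
     (\<forall>v\<in>V. list_size (L v) \<ge> 1) \<and>
     (\<forall>u v. {u, v} \<in> E \<longrightarrow> list_size (L u \<inter> L v) \<le> 1)"

definition L_colorable :: "'a set \<Rightarrow> 'a set set \<Rightarrow> ('a \<Rightarrow> 'c set) \<Rightarrow> bool" where
  "L_colorable V E L \<longleftrightarrow>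
     (\<exists>\<phi>. (\<forall>v\<in>V. \<phi> v \<in> L v) \<and> (\<forall>x y. {x, y} \<in> E \<longrightarrow> \<phi> x \<noteq> \<phi> y))"

end

theory Submission
  imports Defs
begin

text \<open>
  Adjacent lists share at most one color, so an edge is satisfied as soon as one of its ends avoids
  this color. Orient the edges and let each vertex avoid the shared colors of its outgoing edges: a
  coloring exists whenever each vertex has fewer outgoing edges than colors
  (\<open>colorable_by_orientation\<close>). So the task is to find an orientation with outdegrees at most
  \<open>w\<close>, where \<open>w\<close> is \<open>0\<close> on \<open>P\<close>, \<open>1\<close> on the vertices with lists of size two and \<open>2\<close>
  elsewhere; an edge joining the two vertices of \<open>P\<close> is left out, as it is satisfied by hypothesis. By
  Hakimi's theorem (\<open>orientation_exists\<close>) such an orientation exists if every set \<open>W\<close> of vertices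
  spans at most \<open>sum w W\<close> edges.

  This is a sharp form of the bound \<open>2 * n - 4\<close> on the number of edges of a triangle-free planar
  graph (\<open>edge_bounds\<close>). For a 2-edge-connected plane graph, Euler's formula and the fact that
  bounded faces have at least four edges yield \<open>2 * e + b + 4 \<le> 4 * n\<close> where \<open>b\<close> is the number of edges
  on the outer face. The vertices with lists of size two are on the outer face and pairwise nonadjacent,
  and each has two edges there, so \<open>b\<close> is at least twice their number; an edge joining the two
  vertices of \<open>P\<close> contributes one more. Other graphs are split along a cut with at most one edge.

  The embedding consists of arbitrary continuous arcs, and the topological facts rest on the
  Jordan curve theorem and on Janiszewski's theorem: if neither of two compact sets with connected
  intersection separates two points of the plane, then neither does their union. The latter shows that the
  frontier of a face consists of vertices and whole edges (\<open>edge_in_frontier\<close>), that bridges do not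
  separate (\<open>bridge_nonseparating\<close>), that a nonbridge is incident with at most two faces
  (\<open>nonbridge_at_most_two_faces\<close>), and that a vertex of degree at least two on the frontier of a face
  has two edges on it (\<open>two_boundary_edges_at_vertex\<close>).
\<close>

section \<open>Arcs and separation in the plane\<close>

text \<open>
  An arc is one-dimensional, so invariance of dimension forbids it to contain an open set of the
  plane. Hence no face is swallowed when an edge is drawn through it.
\<close>

lemma arc_empty_interior:
  fixes \<gamma> :: "real \<Rightarrow> complex"
  assumes "arc \<gamma>" "open U" "U \<noteq> {}"
  shows "\<not> U \<subseteq> path_image \<gamma>"
proof
  assume sub: "U \<subseteq> path_image \<gamma>"
  obtain h where h: "homeomorphism {0..1} (path_image \<gamma>) \<gamma> h"
    using homeomorphism_arc[OF assms(1)] .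
  have "continuous_on U h" "inj_on h U"
    using h sub unfolding homeomorphism_def
    by (auto intro: continuous_on_subset intro!: inj_on_inverseI[where g = \<gamma>])
  from invariance_of_dimension[OF this(1) assms(2) this(2) assms(3)]
  show False by simp
qed

lemma arc_nonseparating:
  fixes \<gamma> :: "real \<Rightarrow> complex"
  assumes "arc \<gamma>" "a \<notin> path_image \<gamma>" "b \<notin> path_image \<gamma>"
  shows "connected_component (- path_image \<gamma>) a b"
  using connected_arc_complement[OF assms(1)] assms(2,3)
  by (auto simp: connected_iff_connected_component)

lemma ball_nonseparating:
  fixes x :: complex
  assumes "ball x r \<inter> S = {}" "a \<in> ball x r" "b \<in> ball x r"
  shows "connected_component (- S) a b"
  using assms connected_ball[of x r] unfolding connected_component_def by blast

lemma open_ball_avoiding: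
  assumes "closed S" "x \<notin> S"
  obtains r where "r > 0" "ball x r \<inter> S = {}"
  using assms by (metis Compl_iff disjoint_eq_subset_Compl inf_commute open_Compl openE)

text \<open>
  The way in which Janiszewski's theorem is exploited below: cover the frontier of a face \<open>f\<close> by two
  compact sets \<open>S\<close>, \<open>T\<close> meeting in a connected set, neither of which separates a point of \<open>f\<close> from a
  point \<open>b\<close>. Then \<open>K = S \<union> T\<close> does not separate them either, so \<open>b\<close> lies in \<open>f\<close>. This is
  absurd if \<open>b\<close> is a point of the drawing or of another face.
\<close>

lemma frontier_not_crossed:
  assumes "connected_component (- K) a b" "frontier f \<subseteq> K" "a \<in> f"
  shows "b \<in> f"
proof (rule ccontr)
  assume "b \<notin> f"
  obtain T where T: "connected T" "T \<subseteq> - K" "a \<in> T" "b \<in> T"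
    using assms(1) unfolding connected_component_def by blast
  have "T \<inter> frontier f \<noteq> {}"
    using T assms(3) \<open>b \<notin> f\<close> by (intro connected_Int_frontier) auto
  then show False using T assms(2) by blast
qed

lemma frontier_point_near:
  assumes "x \<in> frontier f" "r > 0"
  obtains a where "a \<in> f" "a \<in> ball x r"
proof -
  have "x \<in> closure f" using assms(1) by (simp add: frontier_def)
  then show ?thesis using assms(2) that
    by (metis closure_approachable dist_commute mem_ball)
qed

lemma singleton_int_connected: "A \<inter> B \<subseteq> {x} \<Longrightarrow> connected (A \<inter> B)"
  by (metis connected_empty connected_sing subset_singleton_iff)

section \<open>Edges on the frontier of a face\<close>

abbreviation faces ::
  "'a set \<Rightarrow> 'a set set \<Rightarrow> ('a \<Rightarrow> complex) \<Rightarrow> ('a set \<Rightarrow> real \<Rightarrow> complex) \<Rightarrow> complex set set" where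
  "faces V E pos curve \<equiv> components (- drawing V E pos curve)"

definition boundary_edges ::
  "'a set set \<Rightarrow> ('a set \<Rightarrow> real \<Rightarrow> complex) \<Rightarrow> complex set \<Rightarrow> 'a set set" where
  "boundary_edges E curve f = {e \<in> E. path_image (curve e) \<subseteq> frontier f}"

definition adj :: "'a set set \<Rightarrow> ('a \<times> 'a) set" where
  "adj E = {(x, y). {x, y} \<in> E}"

text \<open>
  Being a bridge is phrased by reachability instead of cycles: a walk that avoids \<open>e\<close> yields the arc
  that closes \<open>e\<close> up to a Jordan curve, and in the absence of such a walk the set of vertices reachable
  from one end of \<open>e\<close> splits the rest of the drawing into two disjoint compact pieces.
\<close>

definition bridge :: "'a set set \<Rightarrow> 'a set \<Rightarrow> bool" where
  "bridge E e \<longleftrightarrow> (\<forall>u v. e = {u, v} \<longrightarrow> (u, v) \<notin> (adj (E - {e}))\<^sup>*)"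

context simple_graph
begin

lemma finite_edges: "finite E"
  using edges finite_vertices by (metis PowI finite_Pow_iff finite_subset subsetI)

lemma edge_ends:
  assumes "e \<in> E"
  obtains u v where "e = {u, v}" "u \<noteq> v" "u \<in> V" "v \<in> V"
  using edges[OF assms] by (auto simp: card_2_iff)

end

context plane_graph
begin

lemma subgraph:
  assumes "W \<subseteq> V" "F \<subseteq> E" "\<And>e. e \<in> F \<Longrightarrow> e \<subseteq> W"
  shows "plane_graph W F pos curve"
proof
  show "finite W" using assms(1) finite_vertices by (rule finite_subset)
  show "e \<subseteq> W \<and> card e = 2" if "e \<in> F" for e using that assms edges by blast
  show "inj_on pos W" using inj_pos assms(1) by (rule inj_on_subset)
  show "arc (curve e)" if "e \<in> F" for e using that assms(2) arc_curve by blast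
  show "{pathstart (curve e), pathfinish (curve e)} = pos ` e" if "e \<in> F" for e
    using that assms(2) curve_ends by blast
  show "path_image (curve e) \<inter> pos ` W = pos ` e" if "e \<in> F" for e
  proof -
    have "path_image (curve e) \<inter> pos ` V = pos ` e" using that assms(2) curve_vertices by blast
    then show ?thesis using assms(1) assms(3)[OF that] by blast
  qed
  show "path_image (curve e) \<inter> path_image (curve f) \<subseteq> pos ` (e \<inter> f)"
    if "e \<in> F" "f \<in> F" "e \<noteq> f" for e f
    using that assms(2) curve_disjoint by blast
qed

lemma spanning_subgraph: "F \<subseteq> E \<Longrightarrow> plane_graph V F pos curve"
  using edges by (intro subgraph) auto

abbreviation D where "D F \<equiv> drawing V F pos curve"
abbreviation img where "img e \<equiv> path_image (curve e)"

lemma compact_drawing: "compact (drawing V E pos curve)"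
  unfolding drawing_def
proof (intro compact_Un compact_UN)
  show "compact (pos ` V)" using finite_vertices by (intro finite_imp_compact) simp
qed (use finite_edges arc_curve in \<open>auto intro: compact_arc_image\<close>)

lemma closed_drawing: "closed (drawing V E pos curve)"
  by (simp add: compact_drawing compact_imp_closed)

lemma compact_drawing_minus: "compact (D (E - X))"
  by (rule plane_graph.compact_drawing[OF spanning_subgraph]) auto

lemma closed_drawing_minus: "closed (D (E - X))"
  by (simp add: compact_drawing_minus compact_imp_closed)

lemma frontier_face: "f \<in> faces V E pos curve \<Longrightarrow> frontier f \<subseteq> D E"
  using closed_drawing by (rule frontier_of_components_closed_complement)

lemma open_face: "f \<in> faces V E pos curve \<Longrightarrow> open f"
  using closed_drawing open_components by blast

lemma face_disjoint: "f \<in> faces V E pos curve \<Longrightarrow> f \<inter> D E = {}"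
  using in_components_subset by fastforce

lemma faces_eq:
  assumes "f \<in> faces V E pos curve" "g \<in> faces V E pos curve" "a \<in> f" "b \<in> g"
    "connected_component (- D E) a b"
  shows "f = g"
proof -
  have "f = connected_component_set (- D E) a" "g = connected_component_set (- D E) b"
    using assms(1-4) by (metis components_iff connected_component_eq)+
  then show ?thesis using assms(5) by (metis connected_component_eq_eq connected_component_in
        connected_component_eq mem_Collect_eq)
qed

lemma edge_arc:
  assumes "{u, v} \<in> E"
  obtains \<gamma> where "arc \<gamma>" "path_image \<gamma> = img {u, v}" "pathstart \<gamma> = pos u" "pathfinish \<gamma> = pos v"
proof -
  let ?c = "curve {u, v}"
  have "{pathstart ?c, pathfinish ?c} = {pos u, pos v}" using curve_ends[OF assms] by simp
  then consider "pathstart ?c = pos u" "pathfinish ?c = pos v"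
    | "pathstart ?c = pos v" "pathfinish ?c = pos u"
    by (auto simp: doubleton_eq_iff)
  then show ?thesis
  proof cases
    case 1 then show ?thesis using that[of ?c] arc_curve[OF assms] by simp
  next
    case 2 then show ?thesis
      using that[of "reversepath ?c"] arc_curve[OF assms] by (simp add: arc_reversepath)
  qed
qed

lemma drawing_split_edge: "e \<in> E \<Longrightarrow> D E = D (E - {e}) \<union> img e"
  by (auto simp: drawing_def)

lemma drawing_Int_edge:
  assumes "e \<in> E"
  shows "D (E - {e}) \<inter> img e = pos ` e"
proof -
  have "img e' \<inter> img e \<subseteq> pos ` e" if "e' \<in> E" "e' \<noteq> e" for e'
    using curve_disjoint[OF that(1) assms that(2)] by blast
  then have "(\<Union>e'\<in>E - {e}. img e') \<inter> img e \<subseteq> pos ` e" by blast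
  moreover have "D (E - {e}) \<inter> img e = img e \<inter> pos ` V \<union> (\<Union>e'\<in>E - {e}. img e') \<inter> img e"
    unfolding drawing_def by blast
  ultimately show ?thesis unfolding curve_vertices[OF assms] by blast
qed

lemma edge_interior_point:
  assumes "e \<in> E"
  obtains x where "x \<in> img e" "x \<notin> D (E - {e})"
proof -
  have "infinite (img e)"
  proof
    assume "finite (img e)"
    moreover have "connected (img e)"
      using arc_curve[OF assms] by (simp add: arc_imp_path connected_path_image)
    ultimately obtain z where "img e = {z}"
      using connected_finite_iff_sing path_image_nonempty by metis
    then show False
      using arc_distinct_ends[OF arc_curve[OF assms]]
      by (metis pathfinish_in_path_image pathstart_in_path_image singletonD)
  qed
  moreover have "finite (pos ` e)"
    using edges[OF assms] finite_vertices finite_subset by blast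
  ultimately have "\<not> img e \<subseteq> pos ` e" by (meson finite_subset)
  then obtain x where x: "x \<in> img e" "x \<notin> pos ` e" by blast
  then have "x \<notin> D (E - {e})" unfolding drawing_Int_edge[OF assms, symmetric] by simp
  with x(1) show ?thesis by (rule that)
qed

text \<open>
  If the curve of \<open>e\<close> had an inner point \<open>\<gamma> t\<close> off the frontier of \<open>f\<close>, a small open piece of it
  around \<open>\<gamma> t\<close> could be erased without touching the frontier. What remains of \<open>e\<close> are two arcs that
  hang at the rest of the drawing by a single point each, and such arcs separate nothing. So \<open>f\<close>,
  which comes close to \<open>e\<close> at \<open>x\<close>, would reach \<open>\<gamma> t\<close>, a point of the drawing.
\<close>

lemma edge_in_frontier:
  assumes f: "f \<in> faces V E pos curve" and e: "e \<in> E"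
    and x: "x \<in> img e" "x \<notin> pos ` e" "x \<in> frontier f"
  shows "img e \<subseteq> frontier f"
proof -
  obtain u v where uv: "e = {u, v}" by (rule edge_ends[OF e])
  obtain \<gamma> where \<gamma>: "arc \<gamma>" "path_image \<gamma> = img e" "pathstart \<gamma> = pos u" "pathfinish \<gamma> = pos v"
    by (rule edge_arc[OF e[unfolded uv], folded uv])
  let ?S = "D (E - {e})"
  have g0: "\<gamma> 0 = pos u" and g1: "\<gamma> 1 = pos v"
    using \<gamma> by (simp_all add: pathstart_def pathfinish_def)
  have im\<gamma>: "img e = \<gamma> ` {0..1}" using \<gamma>(2) by (simp add: path_image_def)
  have inj: "inj_on \<gamma> {0..1}" using \<gamma>(1) by (simp add: arc_def)
  have inner: "\<gamma> ` {0<..<1} \<subseteq> frontier f"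
  proof (rule ccontr)
    assume "\<not> \<gamma> ` {0<..<1} \<subseteq> frontier f"
    then obtain t where t: "0 < t" "t < 1" "\<gamma> t \<notin> frontier f"
      by (meson greaterThanLessThan_iff image_subsetI)
    have tS: "\<gamma> s \<notin> ?S" if "0 < s" "s < 1" for s
    proof
      assume "\<gamma> s \<in> ?S"
      moreover have "\<gamma> s \<in> img e" using that unfolding im\<gamma> by auto
      ultimately have "\<gamma> s \<in> {\<gamma> 0, \<gamma> 1}" using drawing_Int_edge[OF e] uv g0 g1 by auto
      then show False
        using that inj_onD[OF inj, of s 0] inj_onD[OF inj, of s 1] by auto
    qed
    obtain \<delta> where \<delta>: "\<delta> > 0" "ball (\<gamma> t) \<delta> \<inter> frontier f = {}"
      using open_ball_avoiding[OF frontier_closed t(3)] .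
    have "continuous_on {0..1} \<gamma>" using \<gamma>(1) by (simp add: arc_def path_def)
    then obtain d where d0: "d > 0" "\<And>s. s \<in> {0..1} \<Longrightarrow> dist s t < d \<Longrightarrow> dist (\<gamma> s) (\<gamma> t) < \<delta>"
      using t \<delta>(1) unfolding continuous_on_iff by (metis atLeastAtMost_iff less_imp_le)
    have d: "\<gamma> s \<notin> frontier f" if "s \<in> {0..1}" "dist s t < d" for s
      using d0(2)[OF that] \<delta>(2) by (auto simp: dist_commute)
    obtain s1 where s1: "max 0 (t - d) < s1" "s1 < t"
      using dense[of "max 0 (t - d)" t] t d0(1) by auto
    obtain s2 where s2: "t < s2" "s2 < min 1 (t + d)"
      using dense[of t "min 1 (t + d)"] t d0(1) by auto
    have s: "0 < s1" "s1 < t" "t < s2" "s2 < 1" using s1 s2 by auto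
    have mid: "\<gamma> s \<notin> frontier f" if "s1 < s" "s < s2" for s
      using that s1 s2 by (intro d) (auto simp: dist_real_def)
    define e1 where "e1 = subpath 0 s1 \<gamma>"
    define e2 where "e2 = subpath s2 1 \<gamma>"
    have arcs: "arc e1" "arc e2" using \<gamma>(1) s by (auto simp: e1_def e2_def arc_subpath_arc)
    have im: "path_image e1 = \<gamma> ` {0..s1}" "path_image e2 = \<gamma> ` {s2..1}"
      using s by (simp_all add: e1_def e2_def path_image_subpath)
    \<comment> \<open>the remaining drawing, written so that each further piece meets the preceding ones in one point\<close>
    define K where "K = (?S \<union> path_image e1) \<union> path_image e2"
    have frK: "frontier f \<subseteq> K"
    proof
      fix z assume z: "z \<in> frontier f"
      then have "z \<in> ?S \<union> img e" using frontier_face[OF f] drawing_split_edge[OF e] by auto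
      moreover have "z \<in> path_image e1 \<union> path_image e2" if zim: "z \<in> img e"
      proof -
        obtain s where "s \<in> {0..1}" "z = \<gamma> s" using zim unfolding im\<gamma> by blast
        then show ?thesis using mid[of s] z im by force
      qed
      ultimately show "z \<in> K" by (auto simp: K_def)
    qed
    have xS: "x \<notin> ?S" using x drawing_Int_edge[OF e] by blast
    obtain r where r: "r > 0" "ball x r \<inter> ?S = {}"
      using open_ball_avoiding[OF closed_drawing_minus xS] .
    obtain a where a: "a \<in> f" "a \<in> ball x r" using frontier_point_near[OF x(3) r(1)] .
    have aD: "a \<notin> D E" using a face_disjoint[OF f] by blast
    have ax: "connected_component (- ?S) a x" using r a by (intro ball_nonseparating[of x r]) auto
    have "path_connected (\<gamma> ` {0<..<1})"
      using \<gamma>(1) by (intro path_connected_continuous_image)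
        (auto simp: arc_def path_def intro: continuous_on_subset convex_imp_path_connected)
    then have "connected (\<gamma> ` {0<..<1})" by (rule path_connected_imp_connected)
    moreover have "\<gamma> ` {0<..<1} \<subseteq> - ?S" using tS by auto
    moreover have "x \<in> \<gamma> ` {0<..<1}"
    proof -
      obtain s where s: "s \<in> {0..1}" "x = \<gamma> s" using x(1) unfolding im\<gamma> by blast
      moreover have "s \<noteq> 0" "s \<noteq> 1" using x(2) uv g0 g1 s by auto
      ultimately show ?thesis by auto
    qed
    ultimately have "connected_component (- ?S) x (\<gamma> t)"
      unfolding connected_component_def using t by auto
    then have c0: "connected_component (- ?S) a (\<gamma> t)" using ax connected_component_trans by metis
    have gt: "\<gamma> t \<notin> path_image e1" "\<gamma> t \<notin> path_image e2"
      using s t inj_onD[OF inj, of t] unfolding im by force+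
    have "path_image e1 \<subseteq> img e" "path_image e2 \<subseteq> img e"
      unfolding im im\<gamma> using s by (intro image_mono; force)+
    then have ae: "a \<notin> path_image e1" "a \<notin> path_image e2"
      using aD drawing_split_edge[OF e] by blast+
    have i1: "?S \<inter> path_image e1 \<subseteq> {pos u}"
    proof
      fix z assume "z \<in> ?S \<inter> path_image e1"
      then obtain s' where s': "0 \<le> s'" "s' \<le> s1" "z = \<gamma> s'" "\<gamma> s' \<in> ?S" unfolding im by auto
      with tS[of s'] s have "s' = 0" by linarith
      then show "z \<in> {pos u}" using s' g0 by simp
    qed
    have i2: "(?S \<union> path_image e1) \<inter> path_image e2 \<subseteq> {pos v}"
    proof -
      have "?S \<inter> path_image e2 \<subseteq> {pos v}"
      proof
        fix z assume "z \<in> ?S \<inter> path_image e2"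
        then obtain s' where s': "s2 \<le> s'" "s' \<le> 1" "z = \<gamma> s'" "\<gamma> s' \<in> ?S" unfolding im by auto
        with tS[of s'] s have "s' = 1" by linarith
        then show "z \<in> {pos v}" using s' g1 by simp
      qed
      moreover have "path_image e1 \<inter> path_image e2 = {}"
        using s inj_onD[OF inj] unfolding im by force
      ultimately show ?thesis by blast
    qed
    have c1: "connected_component (- (?S \<union> path_image e1)) a (\<gamma> t)"
      by (rule Janiszewski[OF compact_drawing_minus _ singleton_int_connected[OF i1] c0])
        (use arcs ae gt in \<open>auto simp: closed_arc_image intro: arc_nonseparating\<close>)
    have c2: "connected_component (- K) a (\<gamma> t)"
      unfolding K_def
      by (rule Janiszewski[OF _ _ singleton_int_connected[OF i2] c1])
        (use arcs ae gt in \<open>auto simp: compact_drawing_minus compact_Un compact_arc_image closed_arc_image intro: arc_nonseparating\<close>)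
    have "\<gamma> t \<in> f" using frontier_not_crossed[OF c2 frK a(1)] .
    moreover have "\<gamma> t \<in> D E"
      using drawing_split_edge[OF e] t unfolding im\<gamma> by auto
    ultimately show False using face_disjoint[OF f] by blast
  qed
  have "\<gamma> ` closure {0<..<1} \<subseteq> frontier f"
    using \<gamma>(1) inner by (intro image_closure_subset) (auto simp: arc_def path_def)
  then show ?thesis using \<gamma>(2) by (simp add: path_image_def)
qed

end

section \<open>Bridges, faces and boundaries\<close>

lemma adj_mono: "F \<subseteq> G \<Longrightarrow> adj F \<subseteq> adj G"
  by (auto simp: adj_def)

lemma bridge_mono: "bridge E e \<Longrightarrow> F \<subseteq> E \<Longrightarrow> bridge F e"
  unfolding bridge_def using rtrancl_mono[OF adj_mono[of "F - {e}" "E - {e}"]] by blast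

context plane_graph
begin

lemma reachable_in_drawing:
  assumes "(x, y) \<in> (adj E)\<^sup>*" "x \<in> V"
  shows "path_component (drawing V E pos curve) (pos x) (pos y)"
  using assms
proof (induction rule: rtrancl_induct)
  case base
  then show ?case by (auto simp: drawing_def intro: path_component_refl)
next
  case (step y z)
  then have yz: "{y, z} \<in> E" by (simp add: adj_def)
  obtain \<gamma> where \<gamma>: "arc \<gamma>" "path_image \<gamma> = img {y, z}" "pathstart \<gamma> = pos y" "pathfinish \<gamma> = pos z"
    by (rule edge_arc[OF yz])
  have "path_image \<gamma> \<subseteq> D E" unfolding \<gamma>(2) using yz by (auto simp: drawing_def)
  then have "path_component (D E) (pos y) (pos z)"
    unfolding path_component_def using \<gamma> by (meson arc_imp_path)
  then show ?case using step path_component_trans by metis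
qed

text \<open>
  The curve closes \<open>e\<close> up by an arc inside the drawing of the other edges. It therefore meets that
  drawing exactly in this arc, which gives the connected intersection required by Janiszewski's
  theorem.
\<close>

lemma Jordan_curve_through_nonbridge:
  assumes e: "e \<in> E" "\<not> bridge E e"
  obtains c where "simple_path c" "pathfinish c = pathstart c" "img e \<subseteq> path_image c"
    "path_image c \<subseteq> D E" "connected (D (E - {e}) \<inter> path_image c)"
proof -
  obtain u v where uv: "e = {u, v}" and reach: "(u, v) \<in> (adj (E - {e}))\<^sup>*"
    using e(2) unfolding bridge_def by blast
  have "u \<noteq> v" "u \<in> V" "v \<in> V" using edges[OF e(1)] uv by (auto simp: card_2_iff)
  then have ne: "pos u \<noteq> pos v" using inj_pos by (auto simp: inj_on_def)
  interpret G: plane_graph V "E - {e}" pos curve by (rule spanning_subgraph) auto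
  have "path_component (D (E - {e})) (pos u) (pos v)"
    using G.reachable_in_drawing[OF reach \<open>u \<in> V\<close>] .
  then have "path_component (D (E - {e})) (pos v) (pos u)" by (rule path_component_sym)
  then obtain p where p: "path p" "path_image p \<subseteq> D (E - {e})" "pathstart p = pos v" "pathfinish p = pos u"
    unfolding path_component_def by blast
  obtain q where q: "arc q" "path_image q \<subseteq> path_image p" "pathstart q = pos v" "pathfinish q = pos u"
    using path_contains_arc[OF p(1,3,4)] ne by metis
  obtain \<gamma> where \<gamma>: "arc \<gamma>" "path_image \<gamma> = img e" "pathstart \<gamma> = pos u" "pathfinish \<gamma> = pos v"
    by (rule edge_arc[OF e(1)[unfolded uv], folded uv])
  have qD: "path_image q \<subseteq> D (E - {e})" using p q by blast
  then have int: "path_image \<gamma> \<inter> path_image q \<subseteq> {pos u, pos v}"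
    using drawing_Int_edge[OF e(1)] uv unfolding \<gamma>(2) by blast
  let ?c = "\<gamma> +++ q"
  have im: "path_image ?c = img e \<union> path_image q"
    using \<gamma> q by (simp add: path_image_join)
  have "D (E - {e}) \<inter> path_image ?c = path_image q"
  proof -
    have "pos u \<in> path_image q" "pos v \<in> path_image q"
      using q by (metis pathfinish_in_path_image pathstart_in_path_image)+
    then show ?thesis
      unfolding im Int_Un_distrib drawing_Int_edge[OF e(1)] using qD by (auto simp: uv)
  qed
  then have conn: "connected (D (E - {e}) \<inter> path_image ?c)"
    using q(1) by (simp add: arc_imp_path connected_path_image)
  have "simple_path ?c"
    using \<gamma> q int by (intro simple_path_join_loop) auto
  moreover have "pathfinish ?c = pathstart ?c" using \<gamma> q by simp
  moreover have "img e \<subseteq> path_image ?c" unfolding im by blast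
  moreover have "path_image ?c \<subseteq> D E" unfolding im drawing_split_edge[OF e(1)] using qD by blast
  ultimately show ?thesis using conn by (rule that)
qed

text \<open>
  A face lies inside or outside a Jordan curve \<open>c\<close> through \<open>e\<close>, and at most one face on each side has
  \<open>e\<close> on its frontier: points of two such faces near an inner point of \<open>e\<close> are separated neither by
  the drawing without \<open>e\<close> nor, if they are on the same side, by \<open>c\<close>. As these two sets meet in a
  connected set, their union, the whole drawing, does not separate the points.
\<close>

lemma nonbridge_at_most_two_faces:
  assumes e: "e \<in> E" "\<not> bridge E e"
  shows "finite {f \<in> faces V E pos curve. e \<in> boundary_edges E curve f}"
    and "card {f \<in> faces V E pos curve. e \<in> boundary_edges E curve f} \<le> 2"
proof -
  let ?A = "{f \<in> faces V E pos curve. e \<in> boundary_edges E curve f}"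
  obtain c where c: "simple_path c" "pathfinish c = pathstart c" "img e \<subseteq> path_image c"
    "path_image c \<subseteq> D E" "connected (D (E - {e}) \<inter> path_image c)"
    by (rule Jordan_curve_through_nonbridge[OF e])
  let ?I = "inside (path_image c)" and ?O = "outside (path_image c)"
  have J: "open ?I" "open ?O" "connected ?I" "connected ?O" "?I \<inter> ?O = {}" "?I \<union> ?O = - path_image c"
    "frontier ?I = path_image c" "frontier ?O = path_image c"
    using Jordan_inside_outside[OF c(1,2)] by simp_all
  obtain x where x: "x \<in> img e" "x \<notin> D (E - {e})" by (rule edge_interior_point[OF e(1)])
  obtain r where r: "r > 0" "ball x r \<inter> D (E - {e}) = {}"
    by (rule open_ball_avoiding[OF closed_drawing_minus x(2)])
  have "f = g" if f: "f \<in> ?A" and g: "g \<in> ?A"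
    and side: "(f \<inter> ?I = {}) = (g \<inter> ?I = {})" for f g
  proof -
    have "x \<in> frontier f" "x \<in> frontier g"
      using f g x(1) by (auto simp: boundary_edges_def)
    then obtain a b where a: "a \<in> f" "a \<in> ball x r" and b: "b \<in> g" "b \<in> ball x r"
      using frontier_point_near[OF _ r(1)] by metis
    have fg: "f \<in> faces V E pos curve" "g \<in> faces V E pos curve" using f g by auto
    have c1: "connected_component (- D (E - {e})) a b"
      using r(2) a(2) b(2) by (rule ball_nonseparating)
    have whole: "h \<subseteq> ?I \<or> h \<subseteq> ?O"
      if "h \<in> faces V E pos curve" for h
    proof -
      have "h \<subseteq> - path_image c" using face_disjoint[OF that] c(4) by blast
      then have "h \<subseteq> ?I \<union> ?O" using J(6) by simp
      moreover have "connected h" using that by (rule in_components_connected)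
      ultimately have "?I \<inter> h = {} \<or> ?O \<inter> h = {}"
        using J(5) by (intro connectedD[OF _ J(1,2)]) auto
      then show ?thesis using \<open>h \<subseteq> ?I \<union> ?O\<close> by blast
    qed
    have "connected_component (- path_image c) a b"
    proof (cases "f \<inter> ?I = {}")
      case True
      then have "a \<in> ?O" "b \<in> ?O"
        using side whole[OF fg(1)] whole[OF fg(2)] a b by blast+
      moreover have "?O \<subseteq> - path_image c" using J(6) by blast
      ultimately show ?thesis using J(4) unfolding connected_component_def by blast
    next
      case False
      then have "a \<in> ?I" "b \<in> ?I"
        using side J(5) whole[OF fg(1)] whole[OF fg(2)] a b by blast+
      moreover have "?I \<subseteq> - path_image c" using J(6) by blast
      ultimately show ?thesis using J(3) unfolding connected_component_def by blast
    qed
    then have "connected_component (- (D (E - {e}) \<union> path_image c)) a b"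
      using c by (intro Janiszewski compact_drawing_minus c1)
        (auto simp: simple_path_imp_path closed_path_image)
    moreover have "D (E - {e}) \<union> path_image c = D E"
      using c drawing_split_edge[OF e(1)] by blast
    ultimately have "connected_component (- D E) a b" by simp
    then show ?thesis using faces_eq[OF fg a(1) b(1)] by blast
  qed
  then have inj: "inj_on (\<lambda>f. f \<inter> ?I = {}) ?A"
    unfolding inj_on_def by blast
  show "finite ?A" using inj_on_finite[OF inj, of UNIV] by simp
  show "card ?A \<le> 2" using card_inj_on_le[OF inj, of UNIV] by simp
qed

lemma face_within:
  assumes "e \<in> E" "a \<notin> D E"
  shows "connected_component_set (- D E) a \<subseteq> connected_component_set (- D (E - {e})) a"
  using drawing_split_edge[OF assms(1)] by (intro connected_component_mono) blast

text \<open>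
  Erasing an edge only merges faces. Read backwards, this gives a choice of a face of the larger graph
  in each face of the smaller one, injective since faces are disjoint.
\<close>

lemma face_refines:
  assumes e: "e \<in> E" and g: "g \<in> faces V (E - {e}) pos curve"
  obtains f where "f \<in> faces V E pos curve" "f \<subseteq> g"
proof -
  interpret G: plane_graph V "E - {e}" pos curve by (rule spanning_subgraph) auto
  have "\<not> g \<subseteq> img e"
    using arc_empty_interior[OF arc_curve[OF e] G.open_face[OF g] in_components_nonempty[OF g]] .
  then obtain a where a: "a \<in> g" "a \<notin> img e" by blast
  then have aD: "a \<notin> D E" using G.face_disjoint[OF g] drawing_split_edge[OF e] by blast
  have "g = connected_component_set (- D (E - {e})) a"
    using g a by (metis components_iff connected_component_eq)
  then show ?thesis using that[of "connected_component_set (- D E) a"] face_within[OF e aD] aD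
    by (auto simp: components_iff)
qed

text \<open>
  Near an inner point of \<open>e\<close> there are points on both sides of a Jordan curve through \<open>e\<close>. They
  belong to one face once \<open>e\<close> is erased, but to two faces in its presence.
\<close>

lemma nonbridge_splits_face:
  assumes e: "e \<in> E" "\<not> bridge E e"
  obtains f1 f2 g where "f1 \<in> faces V E pos curve" "f2 \<in> faces V E pos curve" "f1 \<noteq> f2"
    "g \<in> faces V (E - {e}) pos curve" "f1 \<subseteq> g" "f2 \<subseteq> g"
proof -
  obtain c where c: "simple_path c" "pathfinish c = pathstart c" "img e \<subseteq> path_image c"
    "path_image c \<subseteq> D E" "connected (D (E - {e}) \<inter> path_image c)"
    by (rule Jordan_curve_through_nonbridge[OF e])
  let ?I = "inside (path_image c)" and ?O = "outside (path_image c)"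
  have J: "open ?I" "open ?O" "connected ?I" "connected ?O" "?I \<inter> ?O = {}" "?I \<union> ?O = - path_image c"
    "frontier ?I = path_image c" "frontier ?O = path_image c"
    using Jordan_inside_outside[OF c(1,2)] by simp_all
  obtain x where x: "x \<in> img e" "x \<notin> D (E - {e})" by (rule edge_interior_point[OF e(1)])
  obtain r where r: "r > 0" "ball x r \<inter> D (E - {e}) = {}"
    by (rule open_ball_avoiding[OF closed_drawing_minus x(2)])
  have "x \<in> frontier ?I" "x \<in> frontier (?O)"
    using J(7,8) x(1) c(3) by auto
  then obtain a b where a: "a \<in> ?I" "a \<in> ball x r"
    and b: "b \<in> ?O" "b \<in> ball x r"
    using frontier_point_near[OF _ r(1)] by metis
  have "a \<notin> path_image c" "b \<notin> path_image c"
    using a b inside_no_overlap outside_no_overlap by blast+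
  then have aD: "a \<notin> D E" and bD: "b \<notin> D E"
    using a b r(2) c(3) unfolding drawing_split_edge[OF e(1)] by blast+
  have ab: "connected_component (- D (E - {e})) a b"
    using r(2) a(2) b(2) by (rule ball_nonseparating)
  have nab: "\<not> connected_component (- D E) a b"
  proof
    assume "connected_component (- D E) a b"
    then have "connected_component (- path_image c) a b"
      using c(4) by (meson Compl_anti_mono connected_component_of_subset)
    moreover have "frontier ?I \<subseteq> path_image c" using J(7) by simp
    ultimately have "b \<in> ?I" using a(1) by (rule frontier_not_crossed)
    then show False using b(1) J(5) by blast
  qed
  have aS: "a \<notin> D (E - {e})" using aD drawing_split_edge[OF e(1)] by blast
  let ?A = "connected_component_set (- D E) a" and ?B = "connected_component_set (- D E) b"
  let ?G = "connected_component_set (- D (E - {e})) a"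
  have ne: "?A \<noteq> ?B"
  proof
    assume "?A = ?B"
    moreover have "b \<in> ?B" using bD by simp
    ultimately show False using nab by blast
  qed
  have fc: "?A \<in> faces V E pos curve" "?B \<in> faces V E pos curve"
    "?G \<in> faces V (E - {e}) pos curve"
    using aD bD aS by (auto intro: componentsI)
  have sA: "?A \<subseteq> ?G" using face_within[OF e(1) aD] .
  have sB: "?B \<subseteq> ?G"
    using face_within[OF e(1) bD] connected_component_eq[of b "- D (E - {e})" a] ab by simp
  show ?thesis by (rule that[OF fc(1,2) ne fc(3) sA sB])
qed

lemma drawing_Int_disjoint:
  assumes "X \<subseteq> V" "Y \<subseteq> V" "X \<inter> Y = {}" "F \<subseteq> E" "G \<subseteq> E"
    "\<And>e. e \<in> F \<Longrightarrow> e \<subseteq> X" "\<And>e. e \<in> G \<Longrightarrow> e \<subseteq> Y"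
  shows "drawing X F pos curve \<inter> drawing Y G pos curve = {}"
proof -
  have p: "pos ` A \<inter> pos ` B = {}" if "A \<subseteq> X" "B \<subseteq> Y" for A B
  proof -
    have "A \<subseteq> V" "B \<subseteq> V" "A \<inter> B = {}" using that assms(1-3) by blast+
    then show ?thesis using inj_on_image_Int[OF inj_pos, of A B] by simp
  qed
  have ve: "pos ` A \<inter> img e = {}" if "A \<subseteq> V" "e \<in> E" "pos ` A \<inter> pos ` e = {}" for A e
    using curve_vertices[OF that(2)] that(1,3) by blast
  have FG: "e \<subseteq> X" "e \<in> E" if "e \<in> F" for e using assms(4,6) that by blast+
  have GY: "e \<subseteq> Y" "e \<in> E" if "e \<in> G" for e using assms(5,7) that by blast+
  have "img e \<inter> img e' = {}" if "e \<in> F" "e' \<in> G" for e e'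
  proof -
    have ee: "e \<inter> e' = {}" using FG(1)[OF that(1)] GY(1)[OF that(2)] assms(3) by blast
    moreover have "e \<noteq> {}" using edges[OF FG(2)[OF that(1)]] by auto
    ultimately have "e \<noteq> e'" by auto
    then show ?thesis
      using curve_disjoint[OF FG(2)[OF that(1)] GY(2)[OF that(2)]] ee by simp
  qed
  moreover have "pos ` X \<inter> img e' = {}" if "e' \<in> G" for e'
    using ve[OF assms(1) GY(2)[OF that]] p[OF order.refl GY(1)[OF that]] .
  moreover have "pos ` Y \<inter> img e = {}" if "e \<in> F" for e
    using ve[OF assms(2) FG(2)[OF that]] p[OF FG(1)[OF that] order.refl] by (simp add: Int_commute)
  ultimately show ?thesis using p[OF order.refl order.refl] unfolding drawing_def by blast
qed

text \<open>
  Without the bridge, the drawing consists of two disjoint compact pieces, one at each end of \<open>e\<close>.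
  The curve of \<open>e\<close> meets the first piece in one point, and the union of both meets the second piece
  in one point, so two applications of Janiszewski's theorem restore the drawing.
\<close>

lemma bridge_nonseparating:
  assumes e: "e \<in> E" "bridge E e" and ab: "connected_component (- D (E - {e})) a b"
    and aD: "a \<notin> D E" and bD: "b \<notin> D E"
  shows "connected_component (- D E) a b"
proof -
  obtain u v where uv: "e = {u, v}" "u \<in> V" "v \<in> V" by (rule edge_ends[OF e(1)])
  define U where "U = {x \<in> V. (u, x) \<in> (adj (E - {e}))\<^sup>*}"
  have uU: "u \<in> U" and vU: "v \<notin> U" using uv e(2) by (auto simp: U_def bridge_def)
  define F1 where "F1 = {e' \<in> E - {e}. e' \<subseteq> U}"
  define F2 where "F2 = {e' \<in> E - {e}. e' \<subseteq> V - U}"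
  define S1 where "S1 = drawing U F1 pos curve"
  define S2 where "S2 = drawing (V - U) F2 pos curve"
  have F: "E - {e} = F1 \<union> F2"
  proof
    show "E - {e} \<subseteq> F1 \<union> F2"
    proof
      fix e' assume e': "e' \<in> E - {e}"
      then obtain x y where xy: "e' = {x, y}" "x \<in> V" "y \<in> V" by (meson DiffD1 edge_ends)
      have "(x, y) \<in> adj (E - {e})" "(y, x) \<in> adj (E - {e})"
        using e' xy by (auto simp: adj_def insert_commute)
      then have "x \<in> U \<longleftrightarrow> y \<in> U" using xy unfolding U_def by (auto intro: rtrancl_into_rtrancl)
      then show "e' \<in> F1 \<union> F2" using e' xy by (auto simp: F1_def F2_def)
    qed
  qed (auto simp: F1_def F2_def)
  have UV: "U \<subseteq> V" by (auto simp: U_def)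
  have DS: "D (E - {e}) = S1 \<union> S2" unfolding F S1_def S2_def drawing_def using UV by auto
  have S12: "S1 \<inter> S2 = {}" unfolding S1_def S2_def
    using UV by (intro drawing_Int_disjoint) (auto simp: F1_def F2_def)
  have "plane_graph U F1 pos curve" "plane_graph (V - U) F2 pos curve"
    using UV by (auto intro!: subgraph simp: F1_def F2_def)
  then have comp: "compact S1" "compact S2"
    unfolding S1_def S2_def by (auto intro: plane_graph.compact_drawing)
  have uS: "pos u \<in> S1" and vS: "pos v \<in> S2"
    using uU vU uv by (auto simp: S1_def S2_def drawing_def)
  have SE: "(S1 \<union> S2) \<inter> img e = {pos u, pos v}"
    using drawing_Int_edge[OF e(1)] unfolding DS by (simp add: uv)
  have nv: "pos v \<notin> S1" and nu: "pos u \<notin> S2" using S12 uS vS by (meson disjoint_iff)+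
  have ends: "z = pos u \<or> z = pos v" if "z \<in> S1 \<or> z \<in> S2" "z \<in> img e" for z
  proof -
    have "z \<in> {pos u, pos v}" unfolding SE[symmetric] using that by simp
    then show ?thesis by simp
  qed
  have i1: "S1 \<inter> img e \<subseteq> {pos u}"
  proof
    fix z assume "z \<in> S1 \<inter> img e"
    then show "z \<in> {pos u}" using ends[of z] nv by auto
  qed
  have i2: "(S1 \<union> img e) \<inter> S2 \<subseteq> {pos v}"
  proof
    fix z assume z: "z \<in> (S1 \<union> img e) \<inter> S2"
    then have "z \<notin> S1" using S12 by (meson IntD2 disjoint_iff)
    then show "z \<in> {pos v}" using ends[of z] nu z by auto
  qed
  have ab': "connected_component (- S1) a b" "connected_component (- S2) a b"
    using ab unfolding DS by (auto elim!: connected_component_of_subset)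
  have arc: "connected_component (- img e) a b"
    using aD bD drawing_split_edge[OF e(1)] arc_curve[OF e(1)] by (auto intro: arc_nonseparating)
  have "connected_component (- (S1 \<union> img e)) a b"
    by (rule Janiszewski[OF comp(1) closed_arc_image[OF arc_curve[OF e(1)]]
          singleton_int_connected[OF i1] ab'(1) arc])
  then have "connected_component (- ((S1 \<union> img e) \<union> S2)) a b"
    by (intro Janiszewski[OF _ _ singleton_int_connected[OF i2] _ ab'(2)])
      (use comp arc_curve[OF e(1)] in \<open>auto simp: compact_Un compact_arc_image compact_imp_closed\<close>)
  moreover have "(S1 \<union> img e) \<union> S2 = D E" using DS drawing_split_edge[OF e(1)] by blast
  ultimately show ?thesis by simp
qed

lemma forest_nonseparating:
  assumes br: "\<And>e. e \<in> E \<Longrightarrow> bridge E e" and aD: "a \<notin> D E" and bD: "b \<notin> D E"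
  shows "connected_component (- D E) a b"
proof -
  have "connected_component (- D F) a b" if "finite F" "F \<subseteq> E" for F
    using that
  proof (induction rule: finite_induct)
    case empty
    have "finite (pos ` V)" using finite_vertices by simp
    then have "connected (- (pos ` V))"
      using path_connected_complement_countable[of "pos ` V"] 
      by (auto intro!: path_connected_imp_connected countable_finite)
    moreover have "D {} = pos ` V" by (simp add: drawing_def)
    ultimately show ?case using aD bD
      by (auto simp: connected_iff_connected_component drawing_def)
  next
    case (insert e F)
    interpret G: plane_graph V "insert e F" pos curve
      using insert.prems by (rule spanning_subgraph)
    have "D (insert e F) \<subseteq> D E" using insert.prems by (auto simp: drawing_def)
    moreover have "insert e F - {e} = F" using insert by auto
    moreover have "bridge (insert e F) e" using br insert.prems by (auto intro: bridge_mono)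
    ultimately show ?case
      using G.bridge_nonseparating[of e a b] insert aD bD by auto
  qed
  then show ?thesis using finite_edges by blast
qed

lemma triangle:
  assumes "triangle_free V E" "{u, x} \<in> E" "{x, v} \<in> E" "{v, u} \<in> E"
  shows False
proof -
  have "is_cycle V E [u, x, v]"
    using assms(2-4) edges[OF assms(2)] edges[OF assms(3)] edges[OF assms(4)]
    by (auto simp: is_cycle_def is_path_def card_2_iff less_Suc_eq doubleton_eq_iff nth_Cons')
  then show False using assms(1) by (auto simp: triangle_free_def)
qed

text \<open>
  A walk that joins the ends \<open>u\<close>, \<open>v\<close> of \<open>e\<close> and avoids \<open>e\<close> leaves \<open>u\<close> by an edge and enters \<open>v\<close> by
  another one. These are all the edges besides \<open>e\<close>, so they must share their other ends and form a
  triangle with \<open>e\<close>.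
\<close>

lemma three_edges_forest:
  assumes tf: "triangle_free V E" and F: "F \<subseteq> E" "card F \<le> 3" and e: "e \<in> F"
  shows "bridge F e"
  unfolding bridge_def
proof (intro allI impI notI)
  fix u v assume uv: "e = {u, v}" and reach: "(u, v) \<in> (adj (F - {e}))\<^sup>*"
  have finF: "finite F" using F finite_edges finite_subset by blast
  have c2: "card d = 2" if "d \<in> F" for d using that F edges by blast
  have ne: "u \<noteq> v" using c2[OF e] uv by auto
  obtain x where ux: "{u, x} \<in> F - {e}"
    using reach ne by (auto elim: converse_rtranclE simp: adj_def)
  obtain y where yv: "{y, v} \<in> F - {e}"
    using reach ne by (auto elim: rtranclE simp: adj_def)
  have x: "x \<noteq> v" "x \<noteq> u" and y: "y \<noteq> u" "y \<noteq> v"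
    using ux yv uv c2[of "{u, x}"] c2[of "{y, v}"] by (auto simp: insert_commute)
  have d: "{u, x} \<noteq> {y, v}" using x ne by (auto simp: doubleton_eq_iff)
  have c2': "card (F - {e}) \<le> 2" using F e finF by (simp add: card_Diff_singleton)
  have "{{u, x}, {y, v}} = F - {e}"
    by (rule card_seteq) (use ux yv d finF c2' in auto)
  then have Fe: "F - {e} = {{u, x}, {y, v}}" by simp
  show False
  proof (cases "x = y")
    case True
    then show False using triangle[OF tf, of u x v] ux yv e uv F by (auto simp: insert_commute)
  next
    case False
    have "z \<in> {u, x}" if "(u, z) \<in> (adj (F - {e}))\<^sup>*" for z
      using that
    proof (induction rule: rtrancl_induct)
      case (step z w)
      then show ?case unfolding Fe using x y False ne by (auto simp: adj_def doubleton_eq_iff)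
    qed simp
    then show False using reach ne x by blast
  qed
qed

lemma frontier_subset_boundary_drawing:
  assumes f: "f \<in> faces V E pos curve"
  shows "frontier f \<subseteq> D (boundary_edges E curve f)"
proof
  fix z assume z: "z \<in> frontier f"
  show "z \<in> D (boundary_edges E curve f)"
  proof (cases "z \<in> pos ` V")
    case False
    then obtain e where e: "e \<in> E" "z \<in> img e"
      using z frontier_face[OF f] by (auto simp: drawing_def)
    moreover have "z \<notin> pos ` e" using False edges[OF e(1)] by blast
    ultimately show ?thesis using edge_in_frontier[OF f e(1) e(2)] z
      by (auto simp: drawing_def boundary_edges_def)
  qed (auto simp: drawing_def)
qed

text \<open>
  The boundary of a bounded face separates it from the outer face, hence is not a forest. In a
  triangle-free graph this takes at least four edges.
\<close>

lemma bounded_face_boundary: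
  assumes tf: "triangle_free V E" and f: "f \<in> faces V E pos curve" "f \<noteq> outer_face V E pos curve"
  shows "4 \<le> card (boundary_edges E curve f)"
proof (rule ccontr)
  let ?B = "boundary_edges E curve f"
  let ?O = "outer_face V E pos curve"
  assume "\<not> 4 \<le> card ?B"
  then have c: "card ?B \<le> 3" by simp
  have BE: "?B \<subseteq> E" by (auto simp: boundary_edges_def)
  interpret B: plane_graph V ?B pos curve using BE by (rule spanning_subgraph)
  have DB: "D ?B \<subseteq> D E" using BE by (auto simp: drawing_def)
  obtain a where a: "a \<in> f" using in_components_nonempty[OF f(1)] by blast
  obtain b where b: "b \<in> ?O"
    using in_components_nonempty[OF outer_face_unbounded_component(1)] by blast
  have O: "?O \<in> faces V E pos curve" by (rule outer_face_unbounded_component(1))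
  have "a \<notin> D ?B" "b \<notin> D ?B"
    using a b face_disjoint[OF f(1)] face_disjoint[OF O] DB by blast+
  then have "connected_component (- D ?B) a b"
    using B.forest_nonseparating three_edges_forest[OF tf BE c] by blast
  then have "b \<in> f"
    using frontier_subset_boundary_drawing[OF f(1)] a by (rule frontier_not_crossed)
  then show False using components_nonoverlap[OF f(1) O] f(2) b by (meson disjoint_iff)
qed

text \<open>
  Suppose that \<open>e\<close> is the only edge at \<open>v\<close> that may lie on the frontier of \<open>f\<close>, and let \<open>e2\<close> be another
  edge at \<open>v\<close>. Cut \<open>e\<close> at its midpoint. Apart from the half \<open>e1\<close> next to \<open>v\<close>, the frontier keeps a
  distance from \<open>v\<close>, and the half \<open>e1\<close> is an arc attached to the rest in a single point, which
  separates nothing. So \<open>f\<close> reaches all points near \<open>v\<close> outside \<open>e1\<close>, among them points of \<open>e2\<close>.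
\<close>

lemma two_boundary_edges_at_vertex:
  assumes f: "f \<in> faces V E pos curve" and v: "v \<in> V" "pos v \<in> frontier f"
    and deg: "2 \<le> card {e \<in> E. v \<in> e}"
  shows "2 \<le> card {e \<in> boundary_edges E curve f. v \<in> e}"
proof (rule ccontr)
  let ?B = "boundary_edges E curve f"
  assume neg: "\<not> 2 \<le> card {e \<in> ?B. v \<in> e}"
  have BE: "?B \<subseteq> E" by (auto simp: boundary_edges_def)
  have finB: "finite {e \<in> ?B. v \<in> e}" 
    using finite_subset[OF BE finite_edges] by simp
  obtain e where e: "e \<in> E" "v \<in> e" and only: "\<And>d. d \<in> ?B \<Longrightarrow> v \<in> d \<Longrightarrow> d = e"
  proof (cases "{e \<in> ?B. v \<in> e} = {}")
    case True
    have "{e \<in> E. v \<in> e} \<noteq> {}" using deg by (metis card.empty not_numeral_le_zero)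
    then show ?thesis using that True by blast
  next
    case False
    then obtain e where e: "e \<in> ?B" "v \<in> e" by blast
    have "card {e \<in> ?B. v \<in> e} \<le> Suc 0" using neg by simp
    then have "\<And>d. d \<in> ?B \<Longrightarrow> v \<in> d \<Longrightarrow> d = e"
      using e finB card_le_Suc0_iff_eq[OF finB] by blast
    then show ?thesis using that[of e] e BE by blast
  qed
  have "\<not> {e \<in> E. v \<in> e} \<subseteq> {e}" using deg card_mono[of "{e}" "{e \<in> E. v \<in> e}"] by auto
  then obtain e2 where e2: "e2 \<in> E" "v \<in> e2" "e2 \<noteq> e" by blast
  obtain w where w: "e = {v, w}" "v \<noteq> w" "w \<in> V" using edges[OF e(1)] e(2) by (auto simp: card_2_iff)
  obtain \<gamma> where \<gamma>: "arc \<gamma>" "path_image \<gamma> = img e" "pathstart \<gamma> = pos v" "pathfinish \<gamma> = pos w"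
    by (rule edge_arc[OF e(1)[unfolded w(1)], folded w(1)])
  have inj: "inj_on \<gamma> {0..1}" using \<gamma>(1) by (simp add: arc_def)
  have g0: "\<gamma> 0 = pos v" and g1: "\<gamma> 1 = pos w"
    using \<gamma> by (simp_all add: pathstart_def pathfinish_def)
  define e1 where "e1 = subpath 0 (1/2) \<gamma>"
  define e1' where "e1' = subpath (1/2) 1 \<gamma>"
  have arcs: "arc e1" "arc e1'" using \<gamma>(1) by (auto simp: e1_def e1'_def arc_subpath_arc)
  have im: "path_image e1 = \<gamma> ` {0..1/2}" "path_image e1' = \<gamma> ` {1/2..1}"
    by (simp_all add: e1_def e1'_def path_image_subpath)
  have im\<gamma>: "img e = \<gamma> ` {0..1}" using \<gamma>(2) by (simp add: path_image_def)
  have "{0..1} = {0..1/2} \<union> {1/2..1::real}" by auto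
  then have ime: "img e = path_image e1 \<union> path_image e1'"
    unfolding im\<gamma> im by (simp only: image_Un)
  define F where "F = {d \<in> ?B. v \<notin> d}"
  define S where "S = drawing (V - {v}) F pos curve \<union> path_image e1'"
  have "plane_graph (V - {v}) F pos curve"
    using BE edges by (intro subgraph) (auto simp: F_def)
  then have "compact (drawing (V - {v}) F pos curve)" by (rule plane_graph.compact_drawing)
  then have compS: "compact S" using arcs by (simp add: S_def compact_Un compact_arc_image)
  have frK: "frontier f \<subseteq> S \<union> path_image e1"
  proof
    fix z assume "z \<in> frontier f"
    then have z: "z \<in> D ?B" using frontier_subset_boundary_drawing[OF f] by blast
    have "pos v \<in> path_image e1" using g0 unfolding im by force
    moreover have "img d \<subseteq> img e" if "d \<in> ?B" "v \<in> d" for d using only[OF that] by simp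
    ultimately show "z \<in> S \<union> path_image e1" using z unfolding drawing_def S_def F_def ime by blast
  qed
  have dr: "drawing (V - {v}) F pos curve \<inter> img e \<subseteq> {pos w}"
  proof -
    have "img d \<inter> img e \<subseteq> {pos w}" if "d \<in> F" for d
    proof -
      have "d \<in> E" "d \<noteq> e" "d \<inter> e \<subseteq> {w}" using that e BE w by (auto simp: F_def)
      then show ?thesis using curve_disjoint[of d e] e(1) image_mono[of "d \<inter> e" "{w}" pos] by simp
    qed
    moreover have "pos ` (V - {v}) \<inter> img e \<subseteq> {pos w}"
    proof
      fix z assume z: "z \<in> pos ` (V - {v}) \<inter> img e"
      have "pos v \<notin> pos ` (V - {v})" using inj_pos v(1) by (auto simp: inj_on_def)
      then have "z \<noteq> pos v" using z by blast
      moreover have "z \<in> img e \<inter> pos ` V" using z by auto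
      then have "z \<in> pos ` e" unfolding curve_vertices[OF e(1)] .
      ultimately show "z \<in> {pos w}" using w(1) by auto
    qed
    ultimately show ?thesis unfolding drawing_def by blast
  qed
  have w1: "pos w \<notin> path_image e1"
    using inj_onD[OF inj, of 1] unfolding im g1[symmetric] by force
  have mid: "path_image e1' \<inter> path_image e1 \<subseteq> {\<gamma> (1/2)}"
  proof
    fix z assume "z \<in> path_image e1' \<inter> path_image e1"
    then obtain s t where st: "s \<in> {1/2..1}" "t \<in> {0..1/2}" "z = \<gamma> s" "\<gamma> s = \<gamma> t" unfolding im by auto
    then have "s = t" using inj_onD[OF inj, of s t] by auto
    then have half: "s = 1/2" using st(1,2) by auto
    show "z \<in> {\<gamma> (1/2)}" using st(3) unfolding half by blast
  qed
  have int: "S \<inter> path_image e1 \<subseteq> {\<gamma> (1/2)}"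
    using dr w1 mid unfolding S_def ime by blast
  have vS: "pos v \<notin> S"
  proof -
    have "pos v \<in> img e" using g0 unfolding im\<gamma> by force
    moreover have "pos v \<noteq> pos w" using inj_pos v(1) w by (auto simp: inj_on_def)
    moreover have "pos v \<notin> path_image e1'"
      using inj_onD[OF inj, of 0] unfolding im g0[symmetric] by force
    ultimately show ?thesis using dr unfolding S_def by blast
  qed
  obtain r where r: "r > 0" "ball (pos v) r \<inter> S = {}"
    by (rule open_ball_avoiding[OF compact_imp_closed[OF compS] vS])
  obtain a where a: "a \<in> f" "a \<in> ball (pos v) r" by (rule frontier_point_near[OF v(2) r(1)])
  have "pos v islimpt img e2"
  proof (rule connected_imp_perfect)
    show "connected (img e2)" using arc_curve[OF e2(1)] by (simp add: arc_imp_path connected_path_image)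
    show "pos v \<in> img e2" using imageI[OF e2(2), of pos] unfolding curve_vertices[OF e2(1), symmetric] by simp
    show "img e2 \<noteq> {x}" for x
      using arc_distinct_ends[OF arc_curve[OF e2(1)]]
      by (metis pathfinish_in_path_image pathstart_in_path_image singletonD)
  qed
  then obtain b where b: "b \<in> img e2" "b \<noteq> pos v" "b \<in> ball (pos v) r"
    using r(1) by (metis islimpt_approachable dist_commute mem_ball)
  have bD: "b \<in> D E" using b(1) e2(1) by (auto simp: drawing_def)
  have "e2 \<inter> e = {v}"
    using edges[OF e2(1)] e2 w by (auto simp: card_2_iff doubleton_eq_iff)
  then have "b \<notin> img e" using curve_disjoint[OF e2(1) e(1) e2(3)] b by auto
  then have b1: "b \<notin> path_image e1" unfolding ime by blast
  have a1: "a \<notin> path_image e1"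
    using a(1) face_disjoint[OF f] drawing_split_edge[OF e(1)] unfolding ime by blast
  have "connected_component (- (S \<union> path_image e1)) a b"
    by (rule Janiszewski[OF compS closed_arc_image[OF arcs(1)] singleton_int_connected[OF int]
          ball_nonseparating[OF r(2) a(2) b(3)] arc_nonseparating[OF arcs(1) a1 b1]])
  then have "b \<in> f" using frK a(1) by (rule frontier_not_crossed)
  then show False using bD face_disjoint[OF f] by blast
qed

end

section \<open>Euler's inequality\<close>

text \<open>
  The vertex sets of the connected components of the graph \<open>(V, E)\<close>, for edge sets on \<open>V\<close>.
\<close>

definition classes :: "'a set \<Rightarrow> 'a set set \<Rightarrow> 'a set set" where
  "classes V E = (\<lambda>x. (adj E)\<^sup>* `` {x}) ` V"

text \<open>
  With more edges each component grows to a component of the larger graph, so the number of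
  components can only drop; it does drop when two of them are joined.
\<close>

lemma classes_supergraph:
  assumes "F \<subseteq> E"
  shows "classes V E = (\<lambda>K. (adj E)\<^sup>* `` K) ` classes V F"
proof -
  have "(adj E)\<^sup>* `` ((adj F)\<^sup>* `` {x}) = (adj E)\<^sup>* `` {x}" for x
    using rtrancl_mono[OF adj_mono[OF assms]] by (auto intro: rtrancl_trans)
  then show ?thesis unfolding classes_def image_image by simp
qed

lemma classes_mono:
  assumes "finite V" "F \<subseteq> E"
  shows "card (classes V E) \<le> card (classes V F)"
  unfolding classes_supergraph[OF assms(2)]
  by (rule card_image_le) (simp add: classes_def assms(1))

lemma classes_bridge:
  assumes "finite V" "u \<in> V" "v \<in> V" "{u, v} \<in> E" "bridge E {u, v}"
  shows "card (classes V E) < card (classes V (E - {{u, v}}))"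
proof -
  let ?F = "E - {{u, v}}" and ?h = "\<lambda>K. (adj E)\<^sup>* `` K"
  have fin: "finite (classes V ?F)" using assms(1) by (simp add: classes_def)
  have "\<not> inj_on ?h (classes V ?F)"
  proof
    assume inj: "inj_on ?h (classes V ?F)"
    have hh: "?h ((adj ?F)\<^sup>* `` {x}) = (adj E)\<^sup>* `` {x}" for x
      using rtrancl_mono[OF adj_mono[of ?F E]] by (auto intro: rtrancl_trans)
    have "(u, v) \<in> adj E" "(v, u) \<in> adj E"
      using assms(4) by (auto simp: adj_def insert_commute)
    then have "(u, z) \<in> (adj E)\<^sup>* \<longleftrightarrow> (v, z) \<in> (adj E)\<^sup>*" for z
      by (meson converse_rtrancl_into_rtrancl)
    then have "(adj E)\<^sup>* `` {u} = (adj E)\<^sup>* `` {v}"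
      by (simp only: Image_singleton)
    then have "?h ((adj ?F)\<^sup>* `` {u}) = ?h ((adj ?F)\<^sup>* `` {v})" unfolding hh .
    moreover have "(adj ?F)\<^sup>* `` {u} \<in> classes V ?F" "(adj ?F)\<^sup>* `` {v} \<in> classes V ?F"
      using assms(2,3) by (simp_all add: classes_def)
    ultimately have "(adj ?F)\<^sup>* `` {u} = (adj ?F)\<^sup>* `` {v}" by (rule inj_onD[OF inj])
    then have "(u, v) \<in> (adj ?F)\<^sup>*" by blast
    then show False using assms(5) by (auto simp: bridge_def)
  qed
  then have "card (?h ` classes V ?F) \<noteq> card (classes V ?F)"
    using eq_card_imp_inj_on[OF fin] by blast
  moreover have "card (?h ` classes V ?F) \<le> card (classes V ?F)" by (rule card_image_le[OF fin])
  moreover have "classes V E = ?h ` classes V ?F" by (rule classes_supergraph) auto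
  ultimately show ?thesis by simp
qed

context plane_graph
begin

text \<open>
  Half of Euler's formula, obtained by adding the edges one at a time: a bridge joins two components, a
  nonbridge splits a face. The faces are exhibited as a finite set because \<open>card\<close> says nothing about
  the set of all faces as long as that set might be infinite.
\<close>

lemma Euler_inequality:
  obtains \<F> where "finite \<F>" "\<F> \<subseteq> faces V E pos curve"
    "card E + card (classes V E) + 1 \<le> card \<F> + card V"
proof -
  have "\<exists>\<F>. finite \<F> \<and> \<F> \<subseteq> faces V F pos curve \<and> card F + card (classes V F) + 1 \<le> card \<F> + card V"
    if "finite F" "F \<subseteq> E" for F
    using that
  proof (induction rule: finite_induct)
    case empty
    interpret G: plane_graph V "{}" pos curve by (rule spanning_subgraph) auto
    have "adj {} = ({} :: ('a \<times> 'a) set)" by (simp add: adj_def)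
    then have "card (classes V {}) \<le> card V"
      unfolding classes_def by (intro card_image_le finite_vertices)
    then show ?case
      using G.outer_face_unbounded_component(1) by (intro exI[of _ "{outer_face V {} pos curve}"]) simp
  next
    case (insert e F)
    let ?G = "insert e F"
    interpret G: plane_graph V ?G pos curve using insert.prems by (rule spanning_subgraph)
    have Ge: "?G - {e} = F" using insert by auto
    obtain \<F> where \<F>: "finite \<F>" "\<F> \<subseteq> faces V F pos curve"
      "card F + card (classes V F) + 1 \<le> card \<F> + card V"
      using insert by auto
    have "\<forall>g\<in>faces V F pos curve. \<exists>f. f \<in> faces V ?G pos curve \<and> f \<subseteq> g"
      using G.face_refines[of e] unfolding Ge by blast
    then obtain s where s: "\<forall>g\<in>faces V F pos curve. s g \<in> faces V ?G pos curve \<and> s g \<subseteq> g"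
      by (auto dest: bchoice)
    have unique: "g = g'" if "g \<in> faces V F pos curve" "g' \<in> faces V F pos curve"
      "h \<in> faces V ?G pos curve" "h \<subseteq> g" "h \<subseteq> g'" for g g' h
      using components_nonoverlap[OF that(1,2)] in_components_nonempty[OF that(3)] that(4,5) by blast
    have inj: "inj_on s (faces V F pos curve)"
      using s unique by (metis (no_types, lifting) inj_onI)
    then have card_s: "card (s ` \<F>) = card \<F>" using \<F>(2) by (meson card_image inj_on_subset)
    obtain u v where uv: "e = {u, v}" "u \<noteq> v" "u \<in> V" "v \<in> V"
      using G.edge_ends[of e] by blast
    show ?case
    proof (cases "bridge ?G e")
      case True
      have "card (classes V ?G) < card (classes V F)"
        using classes_bridge[of V u v ?G] True uv finite_vertices Ge by auto
      then have "card ?G + card (classes V ?G) + 1 \<le> card (s ` \<F>) + card V"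
        using \<F>(3) insert.hyps card_s by simp
      moreover have "s ` \<F> \<subseteq> faces V ?G pos curve" using s \<F>(2) by blast
      ultimately show ?thesis using \<F>(1) by (meson finite_imageI)
    next
      case False
      obtain f1 f2 g where fg: "f1 \<in> faces V ?G pos curve" "f2 \<in> faces V ?G pos curve" "f1 \<noteq> f2"
        "g \<in> faces V F pos curve" "f1 \<subseteq> g" "f2 \<subseteq> g"
        using G.nonbridge_splits_face[OF insertI1 False] unfolding Ge by metis
      \<comment> \<open>one of the two parts of the split face is not the chosen one, and it is the new face\<close>
      define f where "f = (if s g = f1 then f2 else f1)"
      have f: "f \<in> faces V ?G pos curve" "f \<subseteq> g" "f \<noteq> s g" using fg by (auto simp: f_def)
      have "f \<notin> s ` \<F>"
      proof
        assume "f \<in> s ` \<F>"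
        then obtain g' where g': "g' \<in> \<F>" "f = s g'" by blast
        then have "g = g'" using unique[OF fg(4), of g' f] \<F>(2) s f by blast
        then show False using g' f by simp
      qed
      then have "card (insert f (s ` \<F>)) = Suc (card \<F>)" using \<F>(1) card_s by simp
      moreover have "card (classes V ?G) \<le> card (classes V F)"
        by (rule classes_mono[OF finite_vertices]) auto
      ultimately have "card ?G + card (classes V ?G) + 1 \<le> card (insert f (s ` \<F>)) + card V"
        using \<F>(3) insert.hyps by simp
      moreover have "insert f (s ` \<F>) \<subseteq> faces V ?G pos curve" using s \<F>(2) f(1) by blast
      ultimately show ?thesis using \<F>(1) by (meson finite_imageI finite_insert)
    qed
  qed
  from this[OF finite_edges order.refl] show ?thesis using that by blast
qed

end

section \<open>The number of edges of a triangle-free plane graph\<close>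

text \<open>
  For a vertex set \<open>U\<close> these are the edges between \<open>U\<close> and its complement. Cuts with at most one edge,
  which cover both disconnected graphs and graphs with bridges, are where the induction in the edge
  bound below splits the graph.
\<close>

definition cut :: "'a set set \<Rightarrow> 'a set \<Rightarrow> 'a set set" where
  "cut E U = {e \<in> E. e \<inter> U \<noteq> {} \<and> \<not> e \<subseteq> U}"

context plane_graph
begin

lemma no_bridge:
  assumes cuts: "\<And>U. U \<noteq> {} \<Longrightarrow> U \<subset> V \<Longrightarrow> 2 \<le> card (cut E U)" and e: "e \<in> E"
  shows "\<not> bridge E e"
proof
  assume br: "bridge E e"
  obtain u v where uv: "e = {u, v}" "u \<in> V" "v \<in> V" by (rule edge_ends[OF e])
  define U where "U = {x \<in> V. (u, x) \<in> (adj (E - {e}))\<^sup>*}"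
  have "cut E U \<subseteq> {e}"
  proof
    fix d assume d: "d \<in> cut E U"
    show "d \<in> {e}"
    proof (rule ccontr)
      assume "d \<notin> {e}"
      then have dE: "d \<in> E - {e}" using d by (auto simp: cut_def)
      then obtain x y where xy: "d = {x, y}" "x \<in> V" "y \<in> V" by (meson DiffD1 edge_ends)
      have "(x, y) \<in> adj (E - {e})" "(y, x) \<in> adj (E - {e})"
        using dE xy by (auto simp: adj_def insert_commute)
      then have "x \<in> U \<longleftrightarrow> y \<in> U" using xy unfolding U_def by (auto intro: rtrancl_into_rtrancl)
      then show False using d xy by (auto simp: cut_def)
    qed
  qed
  then have "card (cut E U) \<le> 1" using card_mono[of "{e}" "cut E U"] by simp
  moreover have "u \<in> U" "v \<notin> U" using uv br by (auto simp: U_def bridge_def)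
  moreover have "U \<subseteq> V" by (auto simp: U_def)
  ultimately show False using cuts[of U] uv by fastforce
qed

lemma degree_ge_2:
  assumes cuts: "\<And>U. U \<noteq> {} \<Longrightarrow> U \<subset> V \<Longrightarrow> 2 \<le> card (cut E U)"
    and "v \<in> V" "V \<noteq> {v}"
  shows "2 \<le> card {e \<in> E. v \<in> e}"
proof -
  have "2 \<le> card (cut E {v})" using assms(2,3) by (intro cuts) auto
  also have "\<dots> \<le> card {e \<in> E. v \<in> e}"
    using finite_edges by (intro card_mono) (auto simp: cut_def)
  finally show ?thesis .
qed

text \<open>
  Double counting of incident pairs of an edge and a face. Each edge is incident with at most two faces,
  and each face other than the outer one with at least four edges, so the \<open>card E - card V + 2\<close>
  faces supplied by Euler's inequality give
  \<open>card (outer_edges V E pos curve) + 4 * (card E - card V + 1) \<le> 2 * card E\<close>.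
\<close>

lemma two_edge_connected_count:
  assumes tf: "triangle_free V E" and ne: "V \<noteq> {}"
    and cuts: "\<And>U. U \<noteq> {} \<Longrightarrow> U \<subset> V \<Longrightarrow> 2 \<le> card (cut E U)"
  shows "2 * card E + card (outer_edges V E pos curve) + 4 \<le> 4 * card V"
proof -
  let ?O = "outer_face V E pos curve" and ?b = "boundary_edges E curve"
  obtain \<F> where \<F>: "finite \<F>" "\<F> \<subseteq> faces V E pos curve"
    "card E + card (classes V E) + 1 \<le> card \<F> + card V" by (rule Euler_inequality)
  have "0 < card (classes V E)" using ne finite_vertices by (auto simp: classes_def card_gt_0_iff)
  then have euler: "card E + 2 \<le> card \<F> + card V" using \<F>(3) by simp
  define \<H> where "\<H> = insert ?O \<F>"
  have \<H>: "finite \<H>" "\<H> \<subseteq> faces V E pos curve" "?O \<in> \<H>" "card \<F> \<le> card \<H>"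
    using \<F> outer_face_unbounded_component(1) by (auto simp: \<H>_def intro: card_mono)
  have bE: "?b f = {e \<in> E. e \<in> ?b f}" for f by (auto simp: boundary_edges_def)
  have "(\<Sum>f\<in>\<H>. card {e \<in> E. e \<in> ?b f}) = (\<Sum>e\<in>E. card {f \<in> \<H>. e \<in> ?b f})"
    by (rule sum_multicount_gen[OF \<H>(1) finite_edges]) simp
  then have "(\<Sum>f\<in>\<H>. card (?b f)) = (\<Sum>e\<in>E. card {f \<in> \<H>. e \<in> ?b f})"
    unfolding bE[symmetric] .
  also have "\<dots> \<le> (\<Sum>e\<in>E. 2)"
  proof (rule sum_mono)
    fix e assume e: "e \<in> E"
    note two = nonbridge_at_most_two_faces[OF e no_bridge[OF cuts e]]
    have "card {f \<in> \<H>. e \<in> ?b f} \<le> card {f \<in> faces V E pos curve. e \<in> ?b f}"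
      using \<H>(2) two(1) by (intro card_mono) auto
    then show "card {f \<in> \<H>. e \<in> ?b f} \<le> 2" using two(2) by simp
  qed
  finally have upper: "(\<Sum>f\<in>\<H>. card (?b f)) \<le> 2 * card E" by simp
  have "(\<Sum>f\<in>\<H> - {?O}. 4) \<le> (\<Sum>f\<in>\<H> - {?O}. card (?b f))"
    using \<H>(2) by (intro sum_mono bounded_face_boundary[OF tf]) auto
  moreover have "(\<Sum>f\<in>\<H>. card (?b f)) = card (?b ?O) + (\<Sum>f\<in>\<H> - {?O}. card (?b f))"
    using \<H> by (intro sum.remove) auto
  ultimately have "card (?b ?O) + 4 * card (\<H> - {?O}) \<le> 2 * card E" using upper by simp
  moreover have "card (\<H> - {?O}) + 1 = card \<H>" using \<H> by (metis Suc_eq_plus1 card.remove)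
  moreover have "?b ?O = outer_edges V E pos curve" by (simp add: boundary_edges_def outer_edges_def)
  ultimately show ?thesis using euler \<H>(4) by simp
qed

text \<open>
  Every vertex of \<open>A\<close> has two edges on the outer face, and no edge is counted twice as \<open>A\<close> is
  independent.
\<close>

lemma outer_edges_at_independent_set:
  assumes cuts: "\<And>U. U \<noteq> {} \<Longrightarrow> U \<subset> V \<Longrightarrow> 2 \<le> card (cut E U)" and V: "\<And>v. V \<noteq> {v}"
    and A: "A \<subseteq> outer_vertices V E pos curve" and indep: "\<And>u v. u \<in> A \<Longrightarrow> v \<in> A \<Longrightarrow> {u, v} \<notin> E"
  shows "2 * card A \<le> card {e \<in> outer_edges V E pos curve. e \<inter> A \<noteq> {}}"
proof -
  let ?B = "outer_edges V E pos curve"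
  have AV: "A \<subseteq> V" using A by (auto simp: outer_vertices_def)
  have finA: "finite A" using AV finite_vertices finite_subset by blast
  have B: "?B = boundary_edges E curve (outer_face V E pos curve)"
    by (simp add: boundary_edges_def outer_edges_def)
  have finB: "finite ?B" using finite_edges by (simp add: outer_edges_def)
  have "2 * card A = (\<Sum>v\<in>A. 2)" by simp
  also have "\<dots> \<le> (\<Sum>v\<in>A. card {e \<in> ?B. v \<in> e})"
  proof (rule sum_mono)
    fix v assume v: "v \<in> A"
    then show "2 \<le> card {e \<in> ?B. v \<in> e}"
      unfolding B using A AV degree_ge_2[OF cuts _ V]
      by (intro two_boundary_edges_at_vertex outer_face_unbounded_component(1))
        (auto simp: outer_vertices_def)
  qed
  also have "\<dots> = card (\<Union>v\<in>A. {e \<in> ?B. v \<in> e})"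
  proof (rule card_UN_disjoint[symmetric, OF finA])
    show "\<forall>i\<in>A. \<forall>j\<in>A. i \<noteq> j \<longrightarrow> {e \<in> ?B. i \<in> e} \<inter> {e \<in> ?B. j \<in> e} = {}"
    proof (intro ballI impI)
      fix i j assume ij: "i \<in> A" "j \<in> A" "i \<noteq> j"
      have False if "e \<in> ?B" "i \<in> e" "j \<in> e" for e
      proof -
        have eE: "e \<in> E" using that(1) by (simp add: outer_edges_def)
        then have "e = {i, j}" using edges[OF eE] that(2,3) ij(3) by (auto simp: card_2_iff)
        then show False using indep ij eE by blast
      qed
      then show "{e \<in> ?B. i \<in> e} \<inter> {e \<in> ?B. j \<in> e} = {}" by blast
    qed
  qed (use finB in auto)
  also have "(\<Union>v\<in>A. {e \<in> ?B. v \<in> e}) = {e \<in> ?B. e \<inter> A \<noteq> {}}" by blast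
  finally show ?thesis .
qed

end

text \<open>
  Erasing parts of a drawing enlarges its outer face. A vertex or edge on the outer face therefore
  stays there in every subgraph that contains it.
\<close>

lemma frontier_outside_antimono:
  assumes "S \<subseteq> T" "z \<in> S" "z \<in> frontier (outside T)"
  shows "z \<in> frontier (outside S)"
proof -
  have "z \<in> closure (outside S)"
    using assms(3) closure_mono[OF outside_mono[OF assms(1)]] by (auto simp: frontier_def)
  moreover have "z \<notin> interior (outside S)"
    using assms(2) outside_no_overlap[of S] interior_subset by blast
  ultimately show ?thesis by (simp add: frontier_def)
qed

lemma drawing_mono: "W \<subseteq> V \<Longrightarrow> F \<subseteq> E \<Longrightarrow> drawing W F pos curve \<subseteq> drawing V E pos curve"
  by (auto simp: drawing_def)

lemma outer_vertices_subgraph: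
  assumes "W \<subseteq> V" "F \<subseteq> E" "v \<in> outer_vertices V E pos curve" "v \<in> W"
  shows "v \<in> outer_vertices W F pos curve"
proof -
  have "pos v \<in> drawing W F pos curve" using assms(4) by (simp add: drawing_def)
  then show ?thesis
    using frontier_outside_antimono[OF drawing_mono[OF assms(1,2)]] assms(3,4)
    by (simp add: outer_vertices_def outer_face_def)
qed

lemma outer_edges_subgraph:
  assumes "W \<subseteq> V" "F \<subseteq> E" "e \<in> outer_edges V E pos curve" "e \<in> F"
  shows "e \<in> outer_edges W F pos curve"
proof -
  have "path_image (curve e) \<subseteq> drawing W F pos curve" using assms(4) by (auto simp: drawing_def)
  then show ?thesis
    using frontier_outside_antimono[OF drawing_mono[OF assms(1,2)]] assms(3,4)
    unfolding outer_edges_def outer_face_def by blast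
qed

lemma triangle_free_subgraph:
  assumes "triangle_free V E" "W \<subseteq> V" "F \<subseteq> E"
  shows "triangle_free W F"
  using assms unfolding triangle_free_def is_cycle_def is_path_def by blast

lemma card_le_Suc_Diff: "finite A \<Longrightarrow> card A \<le> Suc (card (A - {r}))"
  by (cases "r \<in> A") (simp_all add: card_Suc_Diff1)

lemma (in plane_graph) induced_subgraph: "W \<subseteq> V \<Longrightarrow> plane_graph W (induced_edges E W) pos curve"
  by (rule subgraph) (auto simp: induced_edges_def)

text \<open>
  For 2-edge-connected graphs both bounds come from the double count: the outer face has at least
  \<open>2 * card A\<close> edges at \<open>A\<close>, and an outer edge \<open>{r, s}\<close> with both ends off \<open>A\<close> is one more. The
  remaining half is gained because \<open>card E\<close> is an integer.
  
  The exempted vertex \<open>r\<close> of the first bound is what lets the induction pass through a cut with at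
  most one edge. On the side that does not contain the vertex or edge singled out in the claim, any
  vertex may be exempted: the bound then loses one if this vertex is in \<open>A\<close> and one more for the cut
  edge, and it has a surplus of two from the additive constant, which occurs once on each side.
\<close>

lemma edge_bounds:
  assumes "plane_graph V E pos curve" "triangle_free V E" "V \<noteq> {}"
    and "A \<subseteq> outer_vertices V E pos curve" "\<And>u v. u \<in> A \<Longrightarrow> v \<in> A \<Longrightarrow> {u, v} \<notin> E"
  shows "(\<forall>r\<in>V. card E + card (A - {r}) + 2 \<le> 2 * card V) \<and>
    (\<forall>r s. {r, s} \<in> outer_edges V E pos curve \<longrightarrow> r \<notin> A \<longrightarrow> s \<notin> A \<longrightarrow>
       card E + card A + 3 \<le> 2 * card V)"
  using assms
proof (induction "card V" arbitrary: V E A rule: less_induct)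
  case less
  interpret plane_graph V E pos curve by (rule less.prems(1))
  note tf = less.prems(2) and ne = less.prems(3) and A = less.prems(4) and indep = less.prems(5)
  have AV: "A \<subseteq> V" using A by (auto simp: outer_vertices_def)
  have finA: "finite A" using AV finite_vertices finite_subset by blast
  show ?case
  proof (cases "\<exists>U. U \<noteq> {} \<and> U \<subset> V \<and> card (cut E U) \<le> 1")
    case True
    then obtain U0 where U0: "U0 \<noteq> {}" "U0 \<subset> V" "card (cut E U0) \<le> 1" by blast
    have IH: "(\<forall>r\<in>U. card (induced_edges E U) + card (A \<inter> U - {r}) + 2 \<le> 2 * card U) \<and>
      (\<forall>r s. {r, s} \<in> outer_edges V E pos curve \<longrightarrow> {r, s} \<subseteq> U \<longrightarrow> r \<notin> A \<longrightarrow> s \<notin> A \<longrightarrow>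
         card (induced_edges E U) + card (A \<inter> U) + 3 \<le> 2 * card U)"
      if U: "U \<noteq> {}" "U \<subset> V" for U
    proof -
      have sub: "U \<subseteq> V" "induced_edges E U \<subseteq> E" using U by (auto simp: induced_edges_def)
      have out: "{r, s} \<in> outer_edges U (induced_edges E U) pos curve"
        if "{r, s} \<in> outer_edges V E pos curve" "{r, s} \<subseteq> U" for r s
        using outer_edges_subgraph[OF sub that(1)] that
        by (simp add: induced_edges_def outer_edges_def)
      have "A \<inter> U \<subseteq> outer_vertices U (induced_edges E U) pos curve"
        using outer_vertices_subgraph[OF sub] A by blast
      moreover have "card U < card V" using U finite_vertices by (simp add: psubset_card_mono)
      moreover have "{u, v} \<notin> induced_edges E U" if "u \<in> A \<inter> U" "v \<in> A \<inter> U" for u v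
        using indep that by (auto simp: induced_edges_def)
      ultimately have "(\<forall>r\<in>U. card (induced_edges E U) + card (A \<inter> U - {r}) + 2 \<le> 2 * card U) \<and>
        (\<forall>r s. {r, s} \<in> outer_edges U (induced_edges E U) pos curve \<longrightarrow> r \<notin> A \<inter> U \<longrightarrow> s \<notin> A \<inter> U \<longrightarrow>
           card (induced_edges E U) + card (A \<inter> U) + 3 \<le> 2 * card U)"
        using less.hyps[of U "induced_edges E U" "A \<inter> U"] induced_subgraph[OF sub(1)]
          triangle_free_subgraph[OF tf sub] U(1) by blast
      then show ?thesis using out by blast
    qed
    have split: "card E \<le> card (induced_edges E U) + card (induced_edges E (V - U)) + 1
        \<and> card V = card U + card (V - U) \<and> card A = card (A \<inter> U) + card (A \<inter> (V - U))
        \<and> V - U \<noteq> {} \<and> V - U \<subset> V \<and> card (cut E (V - U)) \<le> 1"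
      if U: "U \<noteq> {}" "U \<subset> V" "card (cut E U) \<le> 1" for U
    proof -
      have "E \<subseteq> (induced_edges E U \<union> induced_edges E (V - U)) \<union> cut E U"
        using edges by (auto simp: induced_edges_def cut_def)
      then have "card E \<le> card ((induced_edges E U \<union> induced_edges E (V - U)) \<union> cut E U)"
        using finite_edges by (intro card_mono) (auto simp: induced_edges_def cut_def)
      also have "\<dots> \<le> card (induced_edges E U) + card (induced_edges E (V - U)) + card (cut E U)"
        by (meson add_mono card_Un_le order.refl order.trans)
      finally have "card E \<le> card (induced_edges E U) + card (induced_edges E (V - U)) + 1"
        using U(3) by simp
      moreover have "card V = card U + card (V - U)"
        using U(2) finite_vertices by (metis card_Diff_subset card_mono finite_subset le_add_diff_inverse psubset_imp_subset)
      moreover have "card A = card (A \<inter> U) + card (A \<inter> (V - U))"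
      proof -
        have "A = (A \<inter> U) \<union> (A \<inter> (V - U))" using AV by blast
        then show ?thesis using finA card_Un_disjoint[of "A \<inter> U" "A \<inter> (V - U)"] by auto
      qed
      moreover have "cut E (V - U) = cut E U" using edges U(2) by (fastforce simp: cut_def)
      ultimately show ?thesis using U by auto
    qed
    have one: "card E + card (A - {r}) + 2 \<le> 2 * card V"
      if U: "U \<noteq> {}" "U \<subset> V" "card (cut E U) \<le> 1" and r: "r \<in> U" for U r
    proof -
      note sp = split[OF U]
      obtain r' where r': "r' \<in> V - U" using sp by blast
      have "card (A - {r}) \<le> card (A \<inter> U - {r}) + card (A \<inter> (V - U))"
      proof -
        have "A - {r} = (A \<inter> U - {r}) \<union> (A \<inter> (V - U))" using AV r by blast
        then show ?thesis by (metis card_Un_le)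
      qed
      moreover have "card (A \<inter> (V - U)) \<le> Suc (card (A \<inter> (V - U) - {r'}))"
        using finA by (intro card_le_Suc_Diff) auto
      moreover have "card (induced_edges E U) + card (A \<inter> U - {r}) + 2 \<le> 2 * card U"
        using IH[OF U(1,2)] r by blast
      moreover have "card (induced_edges E (V - U)) + card (A \<inter> (V - U) - {r'}) + 2 \<le> 2 * card (V - U)"
        using IH[of "V - U"] sp r' by blast
      ultimately show ?thesis using sp by linarith
    qed
    have two: "card E + card A + 3 \<le> 2 * card V"
      if U: "U \<noteq> {}" "U \<subset> V" "card (cut E U) \<le> 1" and rs: "{r, s} \<subseteq> U"
        "{r, s} \<in> outer_edges V E pos curve" "r \<notin> A" "s \<notin> A" for U r s
    proof -
      note sp = split[OF U]
      obtain r' where r': "r' \<in> V - U" using sp by blast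
      have "card (A \<inter> (V - U)) \<le> Suc (card (A \<inter> (V - U) - {r'}))"
        using finA by (intro card_le_Suc_Diff) auto
      moreover have "card (induced_edges E U) + card (A \<inter> U) + 3 \<le> 2 * card U"
        using IH[OF U(1,2)] rs by blast
      moreover have "card (induced_edges E (V - U)) + card (A \<inter> (V - U) - {r'}) + 2 \<le> 2 * card (V - U)"
        using IH[of "V - U"] sp r' by blast
      ultimately show ?thesis using sp by linarith
    qed
    \<comment> \<open>If {r, s} is the cut edge, then r and s are exempted on their sides, at no cost as they avoid A.\<close>
    have crossing: "card E + card A + 3 \<le> 2 * card V"
      if U: "U \<noteq> {}" "U \<subset> V" "card (cut E U) \<le> 1" and rs: "r \<in> U" "s \<in> V - U" "r \<notin> A" "s \<notin> A"
      for U r s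
    proof -
      note sp = split[OF U]
      have "A \<inter> U - {r} = A \<inter> U" "A \<inter> (V - U) - {s} = A \<inter> (V - U)" using rs by auto
      then have "card (induced_edges E U) + card (A \<inter> U) + 2 \<le> 2 * card U"
        "card (induced_edges E (V - U)) + card (A \<inter> (V - U)) + 2 \<le> 2 * card (V - U)"
        using IH[OF U(1,2)] IH[of "V - U"] sp rs by metis+
      then show ?thesis using sp by linarith
    qed
    note sp0 = split[OF U0]
    have U1: "V - U0 \<noteq> {}" "V - U0 \<subset> V" "card (cut E (V - U0)) \<le> 1" using sp0 by auto
    show ?thesis
    proof (intro conjI ballI allI impI)
      fix r assume "r \<in> V"
      then show "card E + card (A - {r}) + 2 \<le> 2 * card V"
        using one[OF U0, of r] one[OF U1, of r] by blast
    next
      fix r s assume rs: "{r, s} \<in> outer_edges V E pos curve" "r \<notin> A" "s \<notin> A"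
      then have "{r, s} \<subseteq> V" using edges by (auto simp: outer_edges_def)
      then consider "{r, s} \<subseteq> U0" | "{r, s} \<subseteq> V - U0" | "r \<in> U0" "s \<in> V - U0"
        | "s \<in> U0" "r \<in> V - U0" by blast
      then show "card E + card A + 3 \<le> 2 * card V"
        using two[OF U0 _ rs] two[OF U1 _ rs] crossing[OF U0 _ _ rs(2,3)] crossing[OF U0 _ _ rs(3,2)]
        by cases blast+
    qed
  next
    case False
    then have cuts: "2 \<le> card (cut E U)" if "U \<noteq> {}" "U \<subset> V" for U
      using that by (metis One_nat_def Suc_1 not_less_eq_eq)
    show ?thesis
    proof (cases "\<exists>v. V = {v}")
      case True
      then obtain v where v: "V = {v}" by blast
      have "E = {}"
      proof (rule equals0I)
        fix e assume "e \<in> E"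
        then have "card e \<le> card V" "card e = 2" 
          using edges[of e] card_mono[OF finite_vertices, of e] by auto
        then show False using v by simp
      qed
      then show ?thesis using v AV by (auto simp: outer_edges_def subset_singleton_iff)
    next
      case False
      let ?B = "outer_edges V E pos curve"
      have finB: "finite ?B" using finite_edges by (simp add: outer_edges_def)
      have cnt: "2 * card E + card ?B + 4 \<le> 4 * card V"
        by (rule two_edge_connected_count[OF tf ne cuts])
      have low: "2 * card A \<le> card {e \<in> ?B. e \<inter> A \<noteq> {}}"
        using False by (intro outer_edges_at_independent_set cuts A indep) auto
      show ?thesis
      proof (intro conjI ballI allI impI)
        fix r assume "r \<in> V"
        have "card (A - {r}) \<le> card A" using finA by (simp add: card_Diff1_le)
        moreover have "card {e \<in> ?B. e \<inter> A \<noteq> {}} \<le> card ?B" using finB by (intro card_mono) auto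
        ultimately show "card E + card (A - {r}) + 2 \<le> 2 * card V" using cnt low by linarith
      next
        fix r s assume rs: "{r, s} \<in> ?B" "r \<notin> A" "s \<notin> A"
        have "{r, s} \<notin> {e \<in> ?B. e \<inter> A \<noteq> {}}" using rs(2,3) by simp
        then have "{e \<in> ?B. e \<inter> A \<noteq> {}} \<noteq> ?B" using rs(1) by metis
        then have "{e \<in> ?B. e \<inter> A \<noteq> {}} \<subset> ?B" by (intro psubsetI) auto
        then have "card {e \<in> ?B. e \<inter> A \<noteq> {}} < card ?B" using finB by (simp add: psubset_card_mono)
        then show "card E + card A + 3 \<le> 2 * card V" using cnt low by linarith
      qed
    qed
  qed
qed

section \<open>Coloring along an orientation\<close>

text \<open>
  Hakimi's theorem: edges can be assigned to ends (\<open>t e\<close> is the tail of \<open>e\<close>) so that each vertex \<open>v\<close> has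
  at most \<open>w v\<close> of them iff no vertex set \<open>W\<close> induces more than \<open>sum w W\<close> edges. Here is the nontrivial
  direction. The new edge \<open>e\<close> is assigned to an end \<open>x\<close> whose capacity may be lowered by one. If neither
  end allows this, each is in a tight set that omits the other end. The number of induced edges is
  supermodular, so the union of the two tight sets is tight as well, leaving no room for \<open>e\<close>, which it
  contains.
\<close>

lemma orientation_exists:
  fixes w :: "'a \<Rightarrow> nat"
  assumes "finite V" "finite E" "\<And>e. e \<in> E \<Longrightarrow> e \<subseteq> V \<and> card e = 2"
    and "\<And>W. W \<subseteq> V \<Longrightarrow> card (induced_edges E W) \<le> sum w W"
  shows "\<exists>t. (\<forall>e\<in>E. t e \<in> e) \<and> (\<forall>v. card {e \<in> E. t e = v} \<le> w v)"
  using assms(2-4)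
proof (induction arbitrary: w rule: finite_induct)
  case empty
  then show ?case by simp
next
  case (insert e F)
  have finW: "finite W" if "W \<subseteq> V" for W using that assms(1) finite_subset by blast
  have fini: "finite (induced_edges F W)" for W using insert.hyps by (simp add: induced_edges_def)
  have mono: "card (induced_edges F W) \<le> sum w W" if "W \<subseteq> V" for W
  proof -
    have "card (induced_edges F W) \<le> card (induced_edges (insert e F) W)"
      using insert.hyps by (intro card_mono) (auto simp: induced_edges_def)
    then show ?thesis using insert.prems(2)[OF that] by simp
  qed
  have strict: "card (induced_edges F W) < sum w W" if "W \<subseteq> V" "e \<subseteq> W" for W
  proof -
    have "induced_edges (insert e F) W = insert e (induced_edges F W)" "e \<notin> induced_edges F W"
      using that(2) insert.hyps by (auto simp: induced_edges_def)
    then have "card (induced_edges (insert e F) W) = Suc (card (induced_edges F W))"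
      using fini by simp
    then show ?thesis using insert.prems(2)[OF that(1)] by simp
  qed
  have eV: "e \<subseteq> V" and "card e = 2" using insert.prems(1)[of e] by auto
  then obtain u v where uv: "e = {u, v}" "u \<noteq> v" by (auto simp: card_2_iff)
  obtain x where x: "x \<in> e" "0 < w x"
    and red: "\<And>W. W \<subseteq> V \<Longrightarrow> card (induced_edges F W) \<le> sum (w(x := w x - 1)) W"
  proof (rule ccontr)
    note witness = that
    assume none: "\<not> thesis"
    have tight: "\<exists>W\<subseteq>V. x \<in> W \<and> sum w W \<le> card (induced_edges F W)" if x: "x \<in> e" for x
    proof (cases "w x = 0")
      case True
      then show ?thesis using x eV by (intro exI[of _ "{x}"]) auto
    next
      case False
      then have "\<not> (\<forall>W\<subseteq>V. card (induced_edges F W) \<le> sum (w(x := w x - 1)) W)"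
        using none witness[OF x] by blast
      then obtain W where W: "W \<subseteq> V" "\<not> card (induced_edges F W) \<le> sum (w(x := w x - 1)) W"
        by blast
      have "x \<in> W"
      proof (rule ccontr)
        assume "x \<notin> W"
        then have "sum (w(x := w x - 1)) W = sum w W" by (intro sum.cong) auto
        then show False using W mono by simp
      qed
      then have "sum w W = w x + sum w (W - {x})"
        "sum (w(x := w x - 1)) W = (w x - 1) + sum (w(x := w x - 1)) (W - {x})"
        using finW[OF W(1)] by (simp_all add: sum.remove)
      moreover have "sum (w(x := w x - 1)) (W - {x}) = sum w (W - {x})" by (intro sum.cong) auto
      ultimately show ?thesis using W \<open>x \<in> W\<close> by (intro exI[of _ W]) auto
    qed
    obtain X where X: "X \<subseteq> V" "u \<in> X" "sum w X \<le> card (induced_edges F X)"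
      using tight[of u] uv by blast
    obtain Y where Y: "Y \<subseteq> V" "v \<in> Y" "sum w Y \<le> card (induced_edges F Y)"
      using tight[of v] uv by blast
    have "card (induced_edges F X) + card (induced_edges F Y)
        = card (induced_edges F X \<union> induced_edges F Y) + card (induced_edges F X \<inter> induced_edges F Y)"
      by (rule card_Un_Int[OF fini fini])
    moreover have "card (induced_edges F X \<union> induced_edges F Y) \<le> card (induced_edges F (X \<union> Y))"
      using fini by (intro card_mono) (auto simp: induced_edges_def)
    moreover have "induced_edges F X \<inter> induced_edges F Y = induced_edges F (X \<inter> Y)"
      by (auto simp: induced_edges_def)
    moreover have "card (induced_edges F (X \<union> Y)) < sum w (X \<union> Y)"
      using X Y uv by (intro strict) auto
    moreover have "card (induced_edges F (X \<inter> Y)) \<le> sum w (X \<inter> Y)" using X by (intro mono) auto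
    moreover have "sum w (X \<union> Y) + sum w (X \<inter> Y) = sum w X + sum w Y"
      using finW X(1) Y(1) by (intro sum.union_inter) auto
    ultimately show False using X(3) Y(3) by simp
  qed
  obtain t where t: "\<forall>e\<in>F. t e \<in> e" "\<forall>y. card {d \<in> F. t d = y} \<le> (w(x := w x - 1)) y"
    using insert.IH[of "w(x := w x - 1)"] insert.prems(1) red by blast
  let ?t = "t(e := x)"
  have "card {d \<in> insert e F. ?t d = y} \<le> w y" for y
  proof (cases "y = x")
    case True
    then have "{d \<in> insert e F. ?t d = y} = insert e {d \<in> F. t d = x}" using insert.hyps by auto
    then have "card {d \<in> insert e F. ?t d = y} = Suc (card {d \<in> F. t d = x})"
      using insert.hyps by simp
    moreover have "card {d \<in> F. t d = x} \<le> w x - 1" using t(2)[rule_format, of x] by simp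
    ultimately show ?thesis using x(2) True by simp
  next
    case False
    then have "{d \<in> insert e F. ?t d = y} = {d \<in> F. t d = y}" using insert.hyps by auto
    then show ?thesis using t(2)[rule_format, of y] False by simp
  qed
  moreover have "\<forall>d\<in>insert e F. ?t d \<in> d" using t(1) x(1) by auto
  ultimately show ?case by blast
qed

text \<open>
  The ends of an edge compete for at most one color, and only the tail is asked to avoid it. Each vertex
  then has at most as many forbidden colors as edges assigned to it, fewer than its list has colors, and
  all vertices can choose independently of each other.
\<close>

lemma colorable_by_orientation:
  assumes fin: "finite E" and e2: "\<And>e. e \<in> E \<Longrightarrow> card e = 2 \<and> e \<subseteq> V"
    and share: "\<And>u v. {u, v} \<in> E \<Longrightarrow> list_size (L u \<inter> L v) \<le> 1"
    and t: "\<And>e. e \<in> E \<Longrightarrow> t e \<in> e" "\<And>v. v \<in> V \<Longrightarrow> enat (card {e \<in> E. t e = v}) < list_size (L v)"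
  shows "L_colorable V E L"
proof -
  \<comment> \<open>the colors forbidden at v\<close>
  define B where "B v = (\<Union>e\<in>{e \<in> E. t e = v}. \<Inter>x\<in>e. L x)" for v
  have one: "finite (\<Inter>x\<in>e. L x) \<and> card (\<Inter>x\<in>e. L x) \<le> 1" if e: "e \<in> E" for e
  proof -
    obtain u v where uv: "e = {u, v}" using e2[OF e] by (auto simp: card_2_iff)
    then have "list_size (L u \<inter> L v) \<le> 1" using share e by simp
    then have "finite (L u \<inter> L v) \<and> card (L u \<inter> L v) \<le> 1"
      by (auto simp: list_size_def one_enat_def split: if_splits)
    then show ?thesis using uv by simp
  qed
  have B: "finite (B v) \<and> card (B v) \<le> card {e \<in> E. t e = v}" for v
  proof -
    have fE: "finite {e \<in> E. t e = v}" using fin by simp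
    have "card (B v) \<le> (\<Sum>e\<in>{e \<in> E. t e = v}. card (\<Inter>x\<in>e. L x))"
      unfolding B_def by (rule card_UN_le[OF fE])
    also have "\<dots> \<le> (\<Sum>e\<in>{e \<in> E. t e = v}. 1)" using one by (intro sum_mono) auto
    finally show ?thesis using one fE by (auto simp: B_def)
  qed
  have "\<exists>c. c \<in> L v - B v" if v: "v \<in> V" for v
  proof (rule ccontr)
    assume "\<nexists>c. c \<in> L v - B v"
    then have sub: "L v \<subseteq> B v" by blast
    then have "finite (L v)" "card (L v) \<le> card {e \<in> E. t e = v}"
      using B[of v] by (auto intro: finite_subset order.trans[OF card_mono])
    then show False using t(2)[OF v] by (simp add: list_size_def)
  qed
  then obtain \<phi> where \<phi>: "\<And>v. v \<in> V \<Longrightarrow> \<phi> v \<in> L v - B v" by metis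
  have "\<phi> x \<noteq> \<phi> y" if xy: "{x, y} \<in> E" for x y
  proof
    assume eq: "\<phi> x = \<phi> y"
    have V: "x \<in> V" "y \<in> V" using e2[OF xy] by auto
    have "\<phi> x \<in> (\<Inter>z\<in>{x, y}. L z)" using \<phi>[OF V(1)] \<phi>[OF V(2)] eq by simp
    then have "\<phi> x \<in> B (t {x, y})" unfolding B_def using xy by blast
    moreover have "t {x, y} = x \<or> t {x, y} = y" using t(1)[OF xy] by simp
    ultimately show False using \<phi>[OF V(1)] \<phi>[OF V(2)] eq by auto
  qed
  then show ?thesis unfolding L_colorable_def using \<phi> by blast
qed

theorem theorem4:
  fixes V :: "'a set" and E :: "'a set set"
    and pos :: "'a \<Rightarrow> complex" and curve :: "'a set \<Rightarrow> real \<Rightarrow> complex"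
    and P :: "'a list" and L :: "'a \<Rightarrow> 'c set"
  assumes "plane_graph V E pos curve"
    and "triangle_free V E"
    and "is_path (outer_vertices V E pos curve) (outer_edges V E pos curve) P"
    and "length P \<le> 2"
    and "star_one_list_assignment V E L"
    and "\<And>v. v \<in> V - outer_vertices V E pos curve \<Longrightarrow> list_size (L v) \<ge> 3"
    and "\<And>v. v \<in> outer_vertices V E pos curve - set P \<Longrightarrow> list_size (L v) \<ge> 2"
    and "\<And>v. v \<in> set P \<Longrightarrow> list_size (L v) = 1"
    and "\<And>u v. \<lbrakk>u \<in> V; v \<in> V; list_size (L u) = 2; list_size (L v) = 2\<rbrakk> \<Longrightarrow> {u, v} \<notin> E"
    and "L_colorable (set P) (induced_edges E (set P)) L"
  shows "L_colorable V E L"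
proof -
  interpret plane_graph V E pos curve by (rule assms(1))
  have PO: "set P \<subseteq> outer_vertices V E pos curve" using assms(3) by (simp add: is_path_def)
  have OV: "outer_vertices V E pos curve \<subseteq> V" by (auto simp: outer_vertices_def)
  \<comment> \<open>the number of edges that v can take care of: one less than its number of colors,
    truncated at two\<close>
  define w :: "'a \<Rightarrow> nat" where
    "w v = (if v \<in> set P then 0 else if list_size (L v) = 2 then 1 else 2)" for v
  have small: "enat (w v) < list_size (L v)" if v: "v \<in> V" for v
  proof (cases "v \<in> set P")
    case True
    then show ?thesis using assms(8) by (simp add: w_def one_enat_def)
  next
    case False
    then have ge: "list_size (L v) \<ge> 2" using assms(6,7) v
      by (cases "v \<in> outer_vertices V E pos curve") (auto intro: order.trans[of _ 3])
    show ?thesis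
      using False ge by (cases "list_size (L v)") (auto simp: w_def numeral_eq_enat)
  qed
  \<comment> \<open>An edge between the two vertices of P is satisfied by hypothesis and needs no tail. With it, the
    capacities could be exceeded by one.\<close>
  define E0 where "E0 = E - induced_edges E (set P)"
  have cap: "card (induced_edges E0 W) \<le> sum w W" if W: "W \<subseteq> V" for W
  proof (cases "W = {}")
    case True
    have "induced_edges E0 W = {}" using True edges by (fastforce simp: induced_edges_def E0_def)
    then show ?thesis by simp
  next
    case False
    have finW: "finite W" using W finite_vertices finite_subset by blast
    let ?H = "induced_edges E W"
    have H: "?H \<subseteq> E" "finite ?H" using finite_edges by (auto simp: induced_edges_def)
    define A where "A = {v \<in> W. list_size (L v) = 2}"
    have finA: "finite A" using finW by (simp add: A_def)
    have AP: "A \<inter> set P = {}" using assms(8) by (auto simp: A_def)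
    have "v \<in> outer_vertices V E pos curve" if "v \<in> A" for v
      using assms(6)[of v] that W by (force simp: A_def)
    then have "A \<subseteq> outer_vertices W ?H pos curve"
      using outer_vertices_subgraph[OF W H(1)] by (auto simp: A_def)
    moreover have "{u, v} \<notin> ?H" if "u \<in> A" "v \<in> A" for u v
      using assms(9)[of u v] that W H(1) by (auto simp: A_def)
    ultimately have bound1: "\<And>r. r \<in> W \<Longrightarrow> card ?H + card (A - {r}) + 2 \<le> 2 * card W"
      and bound2: "\<And>r s. {r, s} \<in> outer_edges W ?H pos curve \<Longrightarrow> r \<notin> A \<Longrightarrow> s \<notin> A \<Longrightarrow>
        card ?H + card A + 3 \<le> 2 * card W"
      using edge_bounds[OF induced_subgraph[OF W] triangle_free_subgraph[OF assms(2) W H(1)] False, of A]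
      by blast+
    have two: "(\<Sum>v\<in>W. w v + (if v \<in> A then 1 else 0) + (if v \<in> set P then 2 else 0)) = (\<Sum>v\<in>W. 2)"
      using assms(8) by (intro sum.cong) (auto simp: w_def A_def)
    have total: "sum w W + card A + 2 * card (W \<inter> set P) = 2 * card W"
    proof -
      have "A = W \<inter> A" by (auto simp: A_def)
      then have "(\<Sum>v\<in>W. if v \<in> A then 1 else 0) = card A"
        using finW by (simp add: sum.If_cases)
      moreover have "(\<Sum>v\<in>W. if v \<in> set P then 2 else 0) = 2 * card (W \<inter> set P)"
        using finW by (simp add: sum.If_cases)
      ultimately show ?thesis using two by (simp add: sum.distrib)
    qed
    have E0H: "induced_edges E0 W \<subseteq> ?H" by (auto simp: induced_edges_def E0_def)
    then have le: "card (induced_edges E0 W) \<le> card ?H" using H(2) by (rule card_mono[rotated])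
    have "card (W \<inter> set P) \<le> card (set P)" by (rule card_mono) auto
    also have "\<dots> \<le> 2" using assms(4) card_length order.trans by blast
    finally consider "card (W \<inter> set P) = 0" | "card (W \<inter> set P) = 1" | "card (W \<inter> set P) = 2"
      by linarith
    then show ?thesis
    proof cases
      case 1
      obtain r where "r \<in> W" using False by blast
      then have "card ?H + card (A - {r}) + 2 \<le> 2 * card W" by (rule bound1)
      then show ?thesis using card_le_Suc_Diff[OF finA, of r] total le 1 by linarith
    next
      case 2
      then obtain r where r: "W \<inter> set P = {r}" by (rule card_1_singletonE)
      then have "r \<in> W" "A - {r} = A" using AP by blast+
      then have "card ?H + card A + 2 \<le> 2 * card W" using bound1[of r] by simp
      then show ?thesis using total le 2 by linarith
    next
      case 3
      then have "2 \<le> length P" using card_length[of P] card_mono[of "set P" "W \<inter> set P"] by simp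
      then obtain r s where P: "P = [r, s]"
        using assms(4) by (cases P; cases "tl P") auto
      have rs: "r \<noteq> s" "{r, s} \<in> outer_edges V E pos curve"
        using assms(3) P by (auto simp: is_path_def)
      have "W \<inter> set P = set P" using 3 P rs by (intro card_subset_eq) auto
      then have "{r, s} \<subseteq> W" using P by auto
      then have rsH: "{r, s} \<in> ?H" using rs(2) by (auto simp: induced_edges_def outer_edges_def)
      have "r \<notin> A" "s \<notin> A" using AP P by auto
      then have b: "card ?H + card A + 3 \<le> 2 * card W"
        using bound2 outer_edges_subgraph[OF W H(1) rs(2) rsH] by blast
      have "{r, s} \<notin> induced_edges E0 W" using P by (auto simp: induced_edges_def E0_def)
      then have "induced_edges E0 W \<subset> ?H" using E0H rsH by blast
      then have "card (induced_edges E0 W) < card ?H" using H(2) by (rule psubset_card_mono[rotated])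
      then show ?thesis using b total 3 by linarith
    qed
  qed
  have "finite E0" "\<And>e. e \<in> E0 \<Longrightarrow> e \<subseteq> V \<and> card e = 2"
    using finite_edges edges by (auto simp: E0_def)
  from orientation_exists[OF finite_vertices this cap] obtain t
    where t: "\<forall>e\<in>E0. t e \<in> e" "\<forall>v. card {e \<in> E0. t e = v} \<le> w v" by blast
  have "L_colorable V E0 L"
  proof (rule colorable_by_orientation)
    show "enat (card {e \<in> E0. t e = v}) < list_size (L v)" if "v \<in> V" for v
      using small[OF that] t(2) by (meson enat_ord_simps(1) order.strict_trans1)
    show "list_size (L u \<inter> L v) \<le> 1" if "{u, v} \<in> E0" for u v
      using assms(5) that by (auto simp: star_one_list_assignment_def E0_def)
  qed (use t \<open>finite E0\<close> edges in \<open>auto simp: E0_def\<close>)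
  then obtain \<phi> where \<phi>: "\<And>v. v \<in> V \<Longrightarrow> \<phi> v \<in> L v" "\<And>x y. {x, y} \<in> E0 \<Longrightarrow> \<phi> x \<noteq> \<phi> y"
    unfolding L_colorable_def by blast
  obtain \<psi> where \<psi>: "\<And>v. v \<in> set P \<Longrightarrow> \<psi> v \<in> L v"
    "\<And>x y. {x, y} \<in> induced_edges E (set P) \<Longrightarrow> \<psi> x \<noteq> \<psi> y"
    using assms(10) unfolding L_colorable_def by blast
  have agree: "\<phi> v = \<psi> v" if v: "v \<in> set P" for v
  proof -
    have "card (L v) = 1" using assms(8)[OF v] by (auto simp: list_size_def one_enat_def split: if_splits)
    then obtain c where "L v = {c}" by (rule card_1_singletonE)
    then show ?thesis using \<phi>(1)[of v] \<psi>(1)[OF v] v PO OV by auto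
  qed
  have "\<phi> x \<noteq> \<phi> y" if xy: "{x, y} \<in> E" for x y
  proof (cases "{x, y} \<in> induced_edges E (set P)")
    case True
    then have "x \<in> set P" "y \<in> set P" by (auto simp: induced_edges_def)
    then show ?thesis using \<psi>(2)[OF True] agree by simp
  next
    case False
    then show ?thesis using xy \<phi>(2) by (simp add: E0_def)
  qed
  then show ?thesis unfolding L_colorable_def using \<phi>(1) by blast
qed

end
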